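(* If $K_1$ and $K_2$ are non-trivial groups belonging to the class $\mathcal{A}$, then the free product $K_1*K_2$ belongs to the class $\mathcal{FPV}$; in particular $K_1*K_2$ embeds as a subgroup of R. Thompson's group $V$.
   Context: R. Thompson's group $V$: let $\mathcal{T}_2$ be the infinite rooted binary tree with nodes labelled by finite binary strings, and let $\mathfrak{C}=\{0,1\}^{\mathbb{N}}$ be the Cantor set, identified with the infinite descending paths from the root. For a node $n$, $\mathfrak{C}_n\subset\mathfrak{C}$ is the set of infinite strings with prefix $n$. $V$ is the group (under composition) of all homeomorphisms of $\mathfrak{C}$ that can be represented by a triple $(D,R,\sigma)$ where $D$, $R$ are finite rooted binary subtrees of $\mathcal{T}_2$ (containing the root of $\mathcal{T}_2$, each node having $0$ or $2$ children in the subtree) with the same number $k$ of leaves and $\sigma$ is a bijection from the leaves of $D$ to the leaves of $R$; the homeomorphism maps $\mathfrak{C}_i$ onto $\mathfrak{C}_{\sigma(i)}$ for each leaf $i$ of $D$ by the prefix replacement $iw\mapsto \sigma(i)w$. $\mathcal{FPV}$ is the class of groups which (1) admit a decomposition as a free product of a pair of non-trivial subgroups, and (2) embed into $V$. $\mathcal{A}$ is the smallest class of groups such that: (1) $\mathcal{A}$ contains all finite groups; (2) $\mathbb{Z}\in\mathcal{A}$; (3) $\mathbb{Q}/\mathbb{Z}\in\mathcal{A}$; (4) $\mathcal{A}$ is closed under (a) isomorphism, (b) passing to subgroups, and (c) taking the direct product of any finite member with any member. *)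

theory Defs
  imports "HOL-Analysis.Analysis" "HOL-Algebra.Algebra" "HOL-Library.Omega_Words_Fun"
begin

section \<open>Thompson's group V\<close>

text \<open>
  Nodes of the infinite rooted binary tree are finite bit strings, the root being \<open>[]\<close>; the
  Cantor set is \<^typ>\<open>nat \<Rightarrow> bool\<close> with its product topology. The string with prefix \<open>n\<close> and
  tail \<open>w\<close> is \<open>n \<frown> w\<close>.
\<close>

definition finite_binary_subtree :: "bool list set \<Rightarrow> bool" where
  "finite_binary_subtree D \<longleftrightarrow>
     finite D \<and> [] \<in> D \<and>
     (\<forall>n b. n @ [b] \<in> D \<longrightarrow> n \<in> D) \<and>
     (\<forall>n\<in>D. n @ [False] \<in> D \<longleftrightarrow> n @ [True] \<in> D)"

definition tree_leaves :: "bool list set \<Rightarrow> bool list set" where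
  "tree_leaves D = {n \<in> D. \<forall>b. n @ [b] \<notin> D}"

definition cone :: "bool list \<Rightarrow> (nat \<Rightarrow> bool) set" where
  "cone n = range (\<lambda>w. n \<frown> w)"

definition represented_by ::
    "((nat \<Rightarrow> bool) \<Rightarrow> (nat \<Rightarrow> bool)) \<Rightarrow>
     bool list set \<Rightarrow> bool list set \<Rightarrow> (bool list \<Rightarrow> bool list) \<Rightarrow> bool" where
  "represented_by f D R \<sigma> \<longleftrightarrow>
     finite_binary_subtree D \<and> finite_binary_subtree R \<and>
     card (tree_leaves D) = card (tree_leaves R) \<and>
     bij_betw \<sigma> (tree_leaves D) (tree_leaves R) \<and>
     (\<forall>i\<in>tree_leaves D. f ` cone i = cone (\<sigma> i) \<and> (\<forall>w. f (i \<frown> w) = \<sigma> i \<frown> w))"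

definition thompson_V :: "((nat \<Rightarrow> bool) \<Rightarrow> (nat \<Rightarrow> bool)) monoid" where
  "thompson_V =
     \<lparr>carrier = {f. (\<exists>g. homeomorphism UNIV UNIV f g) \<and> (\<exists>D R \<sigma>. represented_by f D R \<sigma>)},
      mult = (\<lambda>f g. f \<circ> g),
      one = id\<rparr>"

definition embeds_in :: "('a, 'm) monoid_scheme \<Rightarrow> ('b, 'n) monoid_scheme \<Rightarrow> bool" where
  "embeds_in G H \<longleftrightarrow> (\<exists>h. h \<in> mon G H \<and> subgroup (h ` carrier G) H)"

section \<open>Free products\<close>

text \<open>
  The elements of the free product are the reduced words: alternating sequences of non-identity
  elements of the two factors, tagged by \<^const>\<open>Inl\<close> and \<^const>\<open>Inr\<close>. The product of two
  reduced words is their concatenation, reduced.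
\<close>

definition letters ::
    "('a, 'm) monoid_scheme \<Rightarrow> ('b, 'n) monoid_scheme \<Rightarrow> ('a + 'b) set" where
  "letters G H = Inl ` (carrier G - {\<one>\<^bsub>G\<^esub>}) \<union> Inr ` (carrier H - {\<one>\<^bsub>H\<^esub>})"

definition reduced_words ::
    "('a, 'm) monoid_scheme \<Rightarrow> ('b, 'n) monoid_scheme \<Rightarrow> ('a + 'b) list set" where
  "reduced_words G H =
     {w. set w \<subseteq> letters G H \<and> successively (\<lambda>x y. isl x \<noteq> isl y) w}"

text \<open>Left multiplication of a reduced word by a single letter:\<close>

fun letter_mult ::
    "('a, 'm) monoid_scheme \<Rightarrow> ('b, 'n) monoid_scheme \<Rightarrow>
     'a + 'b \<Rightarrow> ('a + 'b) list \<Rightarrow> ('a + 'b) list" where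
  "letter_mult G H (Inl g) (Inl g' # w) =
     (if g \<otimes>\<^bsub>G\<^esub> g' = \<one>\<^bsub>G\<^esub> then w else Inl (g \<otimes>\<^bsub>G\<^esub> g') # w)"
| "letter_mult G H (Inr h) (Inr h' # w) =
     (if h \<otimes>\<^bsub>H\<^esub> h' = \<one>\<^bsub>H\<^esub> then w else Inr (h \<otimes>\<^bsub>H\<^esub> h') # w)"
| "letter_mult G H x w = x # w"

definition free_product ::
    "('a, 'm) monoid_scheme \<Rightarrow> ('b, 'n) monoid_scheme \<Rightarrow> ('a + 'b) list monoid" where
  "free_product G H =
     \<lparr>carrier = reduced_words G H,
      mult = (\<lambda>u v. foldr (letter_mult G H) u v),
      one = []\<rparr>"

text \<open>
  A group is the free product of two of its subgroups if the canonical homomorphism from their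
  (external) free product, which multiplies out a word in the group, is an isomorphism.
\<close>

definition word_value :: "('a, 'm) monoid_scheme \<Rightarrow> ('a + 'a) list \<Rightarrow> 'a" where
  "word_value G w = foldr (\<lambda>x y. case_sum id id x \<otimes>\<^bsub>G\<^esub> y) w \<one>\<^bsub>G\<^esub>"

definition is_free_product_of ::
    "('a, 'm) monoid_scheme \<Rightarrow> 'a set \<Rightarrow> 'a set \<Rightarrow> bool" where
  "is_free_product_of G A B \<longleftrightarrow>
     subgroup A G \<and> subgroup B G \<and>
     word_value G \<in> iso (free_product (G\<lparr>carrier := A\<rparr>) (G\<lparr>carrier := B\<rparr>)) G"

definition class_FPV :: "('a, 'm) monoid_scheme \<Rightarrow> bool" where
  "class_FPV G \<longleftrightarrow>
     group G \<and>
     (\<exists>A B. is_free_product_of G A B \<and> A \<noteq> {\<one>\<^bsub>G\<^esub>} \<and> B \<noteq> {\<one>\<^bsub>G\<^esub>}) \<and>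
     embeds_in G thompson_V"

section \<open>The class A\<close>

definition rat_mod_int_group :: "rat set monoid" where
  "rat_mod_int_group = \<lparr>carrier = UNIV, mult = (+), one = 0\<rparr> Mod \<int>"

text \<open>
  An inductive predicate lives on a single type of groups. All groups in the class are countable
  (the generating groups are, and the closure operations preserve this), so up to isomorphism they
  all have their elements in \<^typ>\<open>nat\<close>. The class is therefore generated among groups with elements
  in \<^typ>\<open>nat\<close>, where the integers, the rationals modulo 1 and direct products are represented by
  their isomorphic copies, and is then extended along isomorphism to groups over arbitrary types.
\<close>

inductive class_A_nat :: "nat monoid \<Rightarrow> bool" where
  finite: "group G \<Longrightarrow> finite (carrier G) \<Longrightarrow> class_A_nat G"
| integers: "group G \<Longrightarrow> G \<cong> integer_group \<Longrightarrow> class_A_nat G"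
| rat_mod_int: "group G \<Longrightarrow> G \<cong> rat_mod_int_group \<Longrightarrow> class_A_nat G"
| isomorphism: "class_A_nat H \<Longrightarrow> group G \<Longrightarrow> G \<cong> H \<Longrightarrow> class_A_nat G"
| subgroup: "class_A_nat H \<Longrightarrow> subgroup S H \<Longrightarrow> class_A_nat (H\<lparr>carrier := S\<rparr>)"
| product: "class_A_nat F \<Longrightarrow> finite (carrier F) \<Longrightarrow> class_A_nat H \<Longrightarrow>
    group G \<Longrightarrow> G \<cong> F \<times>\<times> H \<Longrightarrow> class_A_nat G"

definition class_A :: "('a, 'm) monoid_scheme \<Rightarrow> bool" where
  "class_A G \<longleftrightarrow> group G \<and> (\<exists>H. class_A_nat H \<and> G \<cong> H)"

end

theory Submission
  imports Defs "HOL-Number_Theory.Cong"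
begin

text \<open>
  The embedding comes from ping-pong on the Cantor set. Call a homomorphism \<open>\<phi>\<close> from a group into
  \<open>V\<close> demonstrative on a set \<open>A\<close> if every non-identity element moves \<open>A\<close> off itself. Suppose that
  two groups act demonstratively on \<open>A\<close> and \<open>B\<close>, that \<open>A\<close> and \<open>B\<close> cover the Cantor set, and that
  they share a point \<open>p\<close>. A non-identity element of the first group sends \<open>A\<close> into the complement of
  \<open>A\<close>, which lies in \<open>B\<close>, and symmetrically. So a non-empty reduced word moves \<open>p\<close> out of \<open>A\<close> or
  out of \<open>B\<close>, according to the factor of its first letter. The images of \<open>p\<close> therefore reveal
  that first letter's factor, and the free product acts faithfully (\<open>ping_pong\<close>). The common point
  \<open>p\<close> makes the argument cover two factors of order two along with all others.

  If every group of the class acts demonstratively on one fixed cone \<open>cone [False]\<close>, conjugating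
  the two actions by suitable elements of \<open>V\<close> produces overlapping sets \<open>A\<close> and \<open>B\<close>
  (\<open>overlapping_translates_of_cone\<close>). Such actions exist by induction over the class.

  \<^item> The integers act through an element of \<open>V\<close> for which the cone is a wandering set.
  \<^item> For a finite group \<open>F\<close>, cut the Cantor set into \<open>card F\<close> copies of itself, one of which contains
    the cone \<open>cone [False]\<close> in its original place, and let \<open>F\<close> permute the copies regularly. If
    another group \<open>H\<close> acts demonstratively, let it act inside all copies simultaneously; this gives
    the direct product of \<open>F\<close> and \<open>H\<close> (\<open>demonstrable_finite_extension\<close>).
  \<^item> For the rationals modulo one, repeat the cutting: at stage \<open>n\<close> there are \<open>n!\<close> pieces, each
    piece of stage \<open>n\<close> being cut into \<open>n + 1\<close> pieces of the next stage. The fraction \<open>p / n!\<close>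
    rotates the pieces of stage \<open>n\<close> by \<open>p\<close> places. Refining the stage does not change the rotation,
    so the finite cyclic actions fit together. The first piece shrinks from stage to stage but
    always contains \<open>cone [False]\<close>, which is what makes the union of the actions demonstrative.

  Membership in \<open>V\<close> is checked through a local criterion (\<open>carrier_thompson_V\<close>): a bijection
  belongs to \<open>V\<close> as soon as every point has a neighbourhood on which it replaces a prefix.
\<close>

section \<open>Thompson's group V as the prefix-replacing bijections\<close>

lemma cone_iff_prefix: "x \<in> cone u \<longleftrightarrow> prefix (length u) x = u"
  unfolding cone_def by (metis prefix_conc_length prefix_suffix rangeE rangeI)

lemma conc_in_cone [simp]: "u \<frown> w \<in> cone u"
  by (simp add: cone_def)

lemma in_cone_prefix [simp]: "x \<in> cone (prefix n x)"
  unfolding cone_iff_prefix by simp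

lemma cone_Nil [simp]: "cone [] = UNIV"
  by (auto simp: cone_iff_prefix)

lemma build_in_cone [simp]: "a ## w \<in> cone (b # u) \<longleftrightarrow> a = b \<and> w \<in> cone u"
  unfolding cone_def by auto

lemma build_cases: obtains (False) w where "x = False ## w" | (True) w where "x = True ## w"
  by (metis build_first)

definition prefix_replacing :: "((nat \<Rightarrow> bool) \<Rightarrow> (nat \<Rightarrow> bool)) \<Rightarrow> bool" where
  "prefix_replacing f \<longleftrightarrow> (\<forall>x. \<exists>u v. x \<in> cone u \<and> (\<forall>w. f (u \<frown> w) = v \<frown> w))"

text \<open>
  A prefix that works may be lengthened, which allows finitely many prefix-replacing maps to be
  expressed over the same prefix of a point.
\<close>

lemma prefix_replacing_eventually:
  assumes "prefix_replacing f"
  obtains n where "\<And>N. n \<le> N \<Longrightarrow> \<exists>v. \<forall>w. f (prefix N x \<frown> w) = v \<frown> w"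
proof -
  obtain u v where uv: "x \<in> cone u" "\<And>w. f (u \<frown> w) = v \<frown> w"
    using assms unfolding prefix_replacing_def by blast
  obtain y where y: "x = u \<frown> y"
    using uv(1) by (auto simp: cone_def)
  have "\<exists>v. \<forall>w. f (prefix N x \<frown> w) = v \<frown> w" if "length u \<le> N" for N
  proof (intro exI allI)
    fix w
    have "prefix N x \<frown> w = u \<frown> (prefix (N - length u) y \<frown> w)"
      using that by (simp add: y)
    then have "f (prefix N x \<frown> w) = v \<frown> (prefix (N - length u) y \<frown> w)"
      by (simp only: uv(2))
    then show "f (prefix N x \<frown> w) = (v @ prefix (N - length u) y) \<frown> w"
      by simp
  qed
  then show ?thesis using that by blast
qed

lemma prefix_replacing_id [simp]: "prefix_replacing id" "prefix_replacing (\<lambda>x. x)"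
  unfolding prefix_replacing_def by (auto intro!: exI[of _ "[]"] simp: cone_def)

lemma prefix_replacing_conc [simp]: "prefix_replacing ((\<frown>) v)"
  unfolding prefix_replacing_def
  by (rule allI, rule exI[of _ "[]"], rule exI[of _ v]) (auto simp: cone_def)

lemma prefix_replacing_build [simp]: "prefix_replacing ((##) a)"
proof -
  have "(\<frown>) [a] = (##) a" by (rule ext) simp
  then show ?thesis by (metis prefix_replacing_conc)
qed

lemma prefix_replacing_comp:
  assumes f: "prefix_replacing f" and g: "prefix_replacing g"
  shows "prefix_replacing (f \<circ> g)"
  unfolding prefix_replacing_def
proof
  fix x
  obtain u v y where u: "x = u \<frown> y" and v: "\<And>w. g (u \<frown> w) = v \<frown> w"
    using g unfolding prefix_replacing_def cone_def by blast
  obtain n where n: "\<And>N. n \<le> N \<Longrightarrow> \<exists>v'. \<forall>w. f (prefix N (g x) \<frown> w) = v' \<frown> w"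
    using prefix_replacing_eventually[OF f] by blast
  have "prefix (length v + n) (g x) = v @ prefix n y"
    by (simp add: u v)
  then obtain v' where "\<And>w. f ((v @ prefix n y) \<frown> w) = v' \<frown> w"
    using n[of "length v + n"] by auto
  then have "\<forall>w. (f \<circ> g) ((u @ prefix n y) \<frown> w) = v' \<frown> w"
    by (simp only: o_apply v conc_conc[symmetric]) simp
  moreover have "x \<in> cone (u @ prefix n y)"
    by (simp add: u cone_iff_prefix)
  ultimately show "\<exists>u v. x \<in> cone u \<and> (\<forall>w. (f \<circ> g) (u \<frown> w) = v \<frown> w)"
    by blast
qed

text \<open>
  A map may be checked for prefix replacement in coordinates: the charts \<open>c i\<close> jointly cover the
  Cantor set, and \<open>h i\<close> is the map read in the chart \<open>c i\<close>. At a point \<open>c i x\<close>, a long prefix of \<open>x\<close>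
  is replaced both by \<open>c i\<close> and by \<open>h i\<close>, so the map exchanges the two results.
\<close>

lemma prefix_replacing_charts:
  assumes "\<And>y. \<exists>i x. y = c i x"
    and c: "\<And>i. prefix_replacing (c i)"
    and h: "\<And>i. prefix_replacing (h i)"
    and g: "\<And>i x. g (c i x) = h i x"
  shows "prefix_replacing g"
  unfolding prefix_replacing_def
proof
  fix y
  obtain i x where y: "y = c i x" using assms(1) by blast
  obtain m where m: "\<And>N. m \<le> N \<Longrightarrow> \<exists>v. \<forall>w. c i (prefix N x \<frown> w) = v \<frown> w"
    using prefix_replacing_eventually[OF c] by blast
  obtain n where n: "\<And>N. n \<le> N \<Longrightarrow> \<exists>v. \<forall>w. h i (prefix N x \<frown> w) = v \<frown> w"
    using prefix_replacing_eventually[OF h] by blast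
  let ?p = "prefix (max m n) x"
  obtain u v where u: "\<And>w. c i (?p \<frown> w) = u \<frown> w" and v: "\<And>w. h i (?p \<frown> w) = v \<frown> w"
    using m[of "max m n"] n[of "max m n"] by auto
  have "y = u \<frown> suffix (max m n) x"
    unfolding y u[symmetric] by simp
  moreover have "g (u \<frown> w) = v \<frown> w" for w
    by (simp only: u[symmetric] v[symmetric] g)
  ultimately show "\<exists>u v. y \<in> cone u \<and> (\<forall>w. g (u \<frown> w) = v \<frown> w)"
    using conc_in_cone by blast
qed

lemma prefix_replacing_inv:
  assumes "bij f" "prefix_replacing f"
  shows "prefix_replacing (inv_into UNIV f)"
proof (rule prefix_replacing_charts[where c = "\<lambda>_::unit. f" and h = "\<lambda>_ x. x"])
  show "\<exists>i x. y = f x" for y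
    using assms(1) by (metis bij_pointE)
  show "inv_into UNIV f (f x) = x" for x
    using assms(1) by (simp add: bij_is_inj)
qed (use assms in simp_all)

lemma open_cone: "open (cone u)"
proof -
  have "x \<in> cone u \<longleftrightarrow> (\<forall>i<length u. x i = u ! i)" for x
    unfolding cone_iff_prefix list_eq_iff_nth_eq by simp
  then have "cone u = (\<Inter>i\<in>{..<length u}. (\<lambda>x. x i) -` {u ! i})"
    by blast
  also have "open \<dots>"
  proof (rule open_INT)
    show "\<forall>i\<in>{..<length u}. open ((\<lambda>x :: nat \<Rightarrow> bool. x i) -` {u ! i})"
    proof
      fix i
      show "open ((\<lambda>x :: nat \<Rightarrow> bool. x i) -` {u ! i})"
        by (rule open_vimage[OF open_discrete continuous_on_product_coordinates])
    qed
  qed simp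
  finally show ?thesis .
qed

lemma compact_cantor: "compact (UNIV :: (nat \<Rightarrow> bool) set)"
proof -
  have "compact_space (product_topology (\<lambda>_::nat. euclidean :: bool topology) UNIV)"
    unfolding compact_space_product_topology
    by (simp add: compact_space_def finite_imp_compact)
  then show ?thesis
    by (simp add: euclidean_product_topology compact_space_def)
qed

lemma prefix_replacing_continuous:
  assumes "prefix_replacing f"
  shows "continuous_on UNIV f"
proof (rule continuous_on_coordinatewise_then_product)
  fix i
  show "continuous_on UNIV (\<lambda>x. f x i)"
    unfolding continuous_on_topological
  proof (intro ballI allI impI)
    fix x B assume "open B" "f x i \<in> B"
    obtain u v where u: "x \<in> cone u" "\<And>w. f (u \<frown> w) = v \<frown> w"
      using assms unfolding prefix_replacing_def by blast
    let ?A = "cone (prefix (length u + i + 1) x)"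
    have A: "f y i = f x i" if y: "y \<in> ?A" for y
    proof -
      obtain z where z: "x = u \<frown> z" using u(1) by (auto simp: cone_def)
      define p where "p = prefix (i + 1) z"
      have "prefix (length u + i + 1) x = u @ p"
        by (simp add: z p_def del: subseq_to_Suc)
      then obtain w where "y = (u @ p) \<frown> w"
        using y by (auto simp only: cone_def)
      then have "f y = v \<frown> (p \<frown> w)"
        by (metis u(2) conc_conc)
      moreover have "f x = v \<frown> z"
        by (simp only: u(2) z)
      ultimately show ?thesis
        by (simp add: p_def conc_def less_Suc_eq_le del: conc_conc subseq_to_Suc)
    qed
    show "\<exists>A. open A \<and> x \<in> A \<and> (\<forall>y\<in>UNIV. y \<in> A \<longrightarrow> f y i \<in> B)"
    proof (intro exI conjI ballI impI)
      show "f y i \<in> B" if "y \<in> ?A" for y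
        using A[OF that] \<open>f x i \<in> B\<close> by simp
    qed (rule open_cone in_cone_prefix)+
  qed
qed

text \<open>
  Compactness turns the local criterion into a uniform depth, hence into a finite tree.
\<close>

lemma prefix_replacing_uniform:
  assumes "prefix_replacing f"
  shows "\<exists>d. \<forall>u. length u = d \<longrightarrow> (\<exists>v. \<forall>w. f (u \<frown> w) = v \<frown> w)"
proof -
  have "\<exists>n. \<forall>N\<ge>n. \<exists>v. \<forall>w. f (prefix N x \<frown> w) = v \<frown> w" for x
    using prefix_replacing_eventually[OF assms] by metis
  then obtain n where n: "\<And>x N. n x \<le> N \<Longrightarrow> \<exists>v. \<forall>w. f (prefix N x \<frown> w) = v \<frown> w"
    by metis
  have "UNIV \<subseteq> (\<Union>x\<in>UNIV. cone (prefix (n x) x))"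
    using in_cone_prefix by blast
  then obtain S where S: "finite S" "UNIV \<subseteq> (\<Union>x\<in>S. cone (prefix (n x) x))"
    using compactE_image[OF compact_cantor, of UNIV "\<lambda>x. cone (prefix (n x) x)"] open_cone
    by metis
  have "\<exists>v. \<forall>w. f (u \<frown> w) = v \<frown> w" if u: "length u = Max (insert 0 (n ` S))" for u
  proof -
    let ?y = "u \<frown> undefined"
    obtain x where x: "x \<in> S" "?y \<in> cone (prefix (n x) x)" using S(2) by blast
    have le: "n x \<le> length u"
      unfolding u by (rule Max_ge) (use x S(1) in auto)
    have p: "prefix (n x) x = take (n x) u"
      using x(2) le by (simp add: cone_iff_prefix)
    obtain v where v: "\<And>w. f (prefix (n x) x \<frown> w) = v \<frown> w"
      using n[of x "n x"] by blast
    have "f (u \<frown> w) = (v @ drop (n x) u) \<frown> w" for w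
    proof -
      have "u \<frown> w = prefix (n x) x \<frown> (drop (n x) u \<frown> w)"
        by (simp add: p)
      then have "f (u \<frown> w) = v \<frown> (drop (n x) u \<frown> w)"
        by (simp only: v)
      then show ?thesis by simp
    qed
    then show ?thesis by blast
  qed
  then show ?thesis by blast
qed

text \<open>
  The longest prefix of \<open>x\<close> in the tree is a leaf: it lacks the child on the path to \<open>x\<close>, hence both.
\<close>

lemma tree_leaf_exists:
  assumes "finite_binary_subtree D"
  shows "\<exists>u\<in>tree_leaves D. x \<in> cone u"
proof -
  let ?S = "{n. prefix n x \<in> D}"
  have "inj_on (\<lambda>n. prefix n x) ?S"
    by (intro inj_onI) (metis diff_zero subsequence_length)
  moreover have "(\<lambda>n. prefix n x) ` ?S \<subseteq> D" by auto
  ultimately have fin: "finite ?S"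
    using assms unfolding finite_binary_subtree_def by (metis finite_subset finite_imageD)
  moreover have "0 \<in> ?S"
    using assms by (simp add: finite_binary_subtree_def)
  ultimately have "Max ?S \<in> ?S" by (intro Max_in) blast+
  then obtain n where n: "prefix n x \<in> D" "n = Max ?S" by blast
  have "prefix (Suc n) x \<notin> D"
    using Max_ge[OF fin, of "Suc n"] n(2) by auto
  then have "prefix n x @ [x n] \<notin> D"
    by simp
  then have "prefix n x @ [b] \<notin> D" for b
    using assms n(1) unfolding finite_binary_subtree_def by (metis (full_types))
  then have "prefix n x \<in> tree_leaves D"
    using n(1) by (simp add: tree_leaves_def)
  then show ?thesis
    using in_cone_prefix by blast
qed

lemma prefix_of_meeting_cone:
  assumes "u \<frown> w = v \<frown> w'" and "length u \<le> length v"
  shows "\<exists>z. v = u @ z"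
proof -
  have "take (length u) v = u"
    using assms by (metis prefix_conc_fst prefix_conc_length)
  then show ?thesis by (metis append_take_drop_id)
qed

text \<open>
  The domain tree is the full binary tree of a depth at which all prefixes are replaced. The range
  tree consists of the prefixes of the replacements. The images of the cones partition the Cantor
  set, so the replacements are pairwise incomparable (hence are the leaves) and cover every
  direction (hence siblings occur together).
\<close>

lemma represented_by_exists:
  assumes "bij f" "prefix_replacing f"
  shows "\<exists>D R \<sigma>. represented_by f D R \<sigma>"
proof -
  obtain N where "\<And>u. length u = N \<Longrightarrow> \<exists>v. \<forall>w. f (u \<frown> w) = v \<frown> w"
    using prefix_replacing_uniform[OF assms(2)] by blast
  then obtain \<sigma> where \<sigma>: "\<And>u w. length u = N \<Longrightarrow> f (u \<frown> w) = \<sigma> u \<frown> w"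
    by metis
  define D where "D = {u :: bool list. length u \<le> N}"
  define L where "L = {u :: bool list. length u = N}"
  define R where "R = {v. \<exists>u\<in>L. \<exists>z. \<sigma> u = v @ z}"
  have finL: "finite L" and finD: "finite D"
    using finite_lists_length_eq[of "UNIV :: bool set" N]
      finite_lists_length_le[of "UNIV :: bool set" N] by (auto simp: L_def D_def)
  have Lne: "replicate N False \<in> L" by (simp add: L_def)
  have D: "finite_binary_subtree D"
    using finD by (auto simp: finite_binary_subtree_def D_def)
  have leavesD: "tree_leaves D = L"
    by (auto simp: tree_leaves_def D_def L_def)
  have incomparable: "u = u' \<and> z = []" if "u \<in> L" "u' \<in> L" "\<sigma> u' = \<sigma> u @ z" for u u' z
  proof -
    have "f (u \<frown> (z \<frown> w)) = f (u' \<frown> w)" for w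
      using that by (simp add: L_def \<sigma>[of u "z \<frown> w"] \<sigma>[of u' w] del: conc_conc)
        (simp add: \<sigma>)
    then have "u \<frown> (z \<frown> w) = u' \<frown> w" for w
      using assms(1) by (metis bij_pointE)
    moreover have "length u = length u'"
      using that by (simp add: L_def)
    ultimately have "u = u'"
      using concat_eq by blast
    then show ?thesis using that by simp
  qed
  have cover: "\<exists>u\<in>L. x \<in> cone (\<sigma> u)" for x
  proof -
    obtain y where y: "f y = x" using assms(1) by (metis bij_pointE)
    have "f y = \<sigma> (prefix N y) \<frown> suffix N y"
      using \<sigma>[of "prefix N y" "suffix N y"] by simp
    then show ?thesis
      using y by (intro bexI[of _ "prefix N y"]) (auto simp: L_def)
  qed
  have finR: "finite R"
  proof -
    have "R \<subseteq> (\<Union>u\<in>L. (\<lambda>k. take k (\<sigma> u)) ` {..length (\<sigma> u)})"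
    proof
      fix v assume "v \<in> R"
      then obtain u z where u: "u \<in> L" "\<sigma> u = v @ z"
        by (auto simp: R_def)
      then have "v = take (length v) (\<sigma> u)" "length v \<in> {..length (\<sigma> u)}"
        by simp_all
      then show "v \<in> (\<Union>u\<in>L. (\<lambda>k. take k (\<sigma> u)) ` {..length (\<sigma> u)})"
        using u(1) by blast
    qed
    then show ?thesis using finL by (auto intro: finite_subset)
  qed
  have sibling: "v @ [\<not> b] \<in> R" if vb: "v @ [b] \<in> R" for v b
  proof -
    obtain u z where u: "u \<in> L" "\<sigma> u = (v @ [b]) @ z"
      using vb unfolding R_def by blast
    obtain u' where u': "u' \<in> L" "(v @ [\<not> b]) \<frown> undefined \<in> cone (\<sigma> u')"
      using cover by blast
    then obtain w where w: "(v @ [\<not> b]) \<frown> undefined = \<sigma> u' \<frown> w"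
      by (auto simp: cone_def)
    show ?thesis
    proof (cases "length (v @ [\<not> b]) \<le> length (\<sigma> u')")
      case True
      then show ?thesis
        using prefix_of_meeting_cone[OF w] u' by (auto simp: R_def)
    next
      case False
      then obtain z' where z': "v @ [\<not> b] = \<sigma> u' @ z'"
        using prefix_of_meeting_cone[OF w[symmetric]] by auto
      moreover have "z' \<noteq> []"
        using False z' by (metis append_Nil2 le_refl)
      ultimately obtain z'' where "v = \<sigma> u' @ z''"
        by (metis append_butlast_last_id butlast_append butlast_snoc)
      then have "\<sigma> u = \<sigma> u' @ (z'' @ [b] @ z)"
        using u by simp
      then show ?thesis
        using incomparable[OF u'(1) u(1)] by blast
    qed
  qed
  have R: "finite_binary_subtree R"
    unfolding finite_binary_subtree_def
  proof (intro conjI allI impI ballI)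
    show "finite R" by (rule finR)
    show "[] \<in> R" using Lne by (auto simp: R_def)
    show "n \<in> R" if "n @ [b] \<in> R" for n b
      using that by (auto simp: R_def)
    show "n @ [False] \<in> R \<longleftrightarrow> n @ [True] \<in> R" for n
      using sibling[of n True] sibling[of n False] by auto
  qed
  have leavesR: "tree_leaves R = \<sigma> ` L"
  proof (intro equalityI subsetI)
    fix v assume v: "v \<in> tree_leaves R"
    then obtain u z where u: "u \<in> L" "\<sigma> u = v @ z"
      by (auto simp: tree_leaves_def R_def)
    have "z = []"
    proof (cases z)
      case (Cons b z')
      then have "v @ [b] \<in> R" using u by (auto simp: R_def)
      then show ?thesis using v by (simp add: tree_leaves_def)
    qed
    then show "v \<in> \<sigma> ` L" using u by auto
  next
    fix v assume "v \<in> \<sigma> ` L"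
    then obtain u where u: "u \<in> L" "v = \<sigma> u" by blast
    have "v @ [b] \<notin> R" for b
    proof
      assume "v @ [b] \<in> R"
      then obtain u' z where "u' \<in> L" "\<sigma> u' = \<sigma> u @ ([b] @ z)"
        using u by (auto simp: R_def)
      then show False using incomparable[OF u(1)] by blast
    qed
    moreover have "v \<in> R" using u by (auto simp: R_def)
    ultimately show "v \<in> tree_leaves R" by (simp add: tree_leaves_def)
  qed
  have bij: "bij_betw \<sigma> L (\<sigma> ` L)"
    unfolding bij_betw_def
    by (auto intro!: inj_onI) (metis append_Nil2 incomparable)
  have "represented_by f D R \<sigma>"
    unfolding represented_by_def leavesD leavesR
  proof (intro conjI ballI allI)
    show "card L = card (\<sigma> ` L)" using bij by (rule bij_betw_same_card)
    show "f ` cone u = cone (\<sigma> u)" if "u \<in> L" for u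
      using that \<sigma> by (auto simp: cone_def L_def image_image)
    show "f (u \<frown> w) = \<sigma> u \<frown> w" if "u \<in> L" for u w
      using that \<sigma> by (auto simp: L_def)
  qed (use D R bij in auto)
  then show ?thesis by blast
qed

lemma carrier_thompson_V: "carrier thompson_V = {f. bij f \<and> prefix_replacing f}"
proof (intro equalityI subsetI)
  fix f assume "f \<in> carrier thompson_V"
  then obtain g D R \<sigma> where g: "homeomorphism UNIV UNIV f g" and r: "represented_by f D R \<sigma>"
    by (auto simp: thompson_V_def)
  have "bij f"
    using g unfolding homeomorphism_def by (intro o_bij[of g f]) auto
  moreover have "prefix_replacing f"
    unfolding prefix_replacing_def
  proof
    fix x
    have "finite_binary_subtree D"
      using r by (simp add: represented_by_def)
    then obtain u where u: "u \<in> tree_leaves D" "x \<in> cone u"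
      using tree_leaf_exists by blast
    have "\<forall>w. f (u \<frown> w) = \<sigma> u \<frown> w"
      using r u(1) by (simp add: represented_by_def)
    then show "\<exists>u v. x \<in> cone u \<and> (\<forall>w. f (u \<frown> w) = v \<frown> w)"
      using u(2) by blast
  qed
  ultimately show "f \<in> {f. bij f \<and> prefix_replacing f}" by blast
next
  fix f assume "f \<in> {f. bij f \<and> prefix_replacing f}"
  then have f: "bij f" "prefix_replacing f" by auto
  have "bij (inv_into UNIV f)" "\<And>x. inv_into UNIV f (f x) = x" "\<And>y. f (inv_into UNIV f y) = y"
    using f(1) by (simp_all add: bij_imp_bij_inv bij_is_inj bij_is_surj surj_f_inv_f)
  then have "homeomorphism UNIV UNIV f (inv_into UNIV f)"
    unfolding homeomorphism_def
    using f prefix_replacing_continuous prefix_replacing_inv by (simp add: bij_is_surj)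
  then show "f \<in> carrier thompson_V"
    using represented_by_exists[OF f] by (auto simp: thompson_V_def)
qed

lemma mult_thompson_V [simp]: "f \<otimes>\<^bsub>thompson_V\<^esub> g = f \<circ> g"
  and one_thompson_V [simp]: "\<one>\<^bsub>thompson_V\<^esub> = id"
  by (simp_all add: thompson_V_def)

lemma group_thompson_V: "group thompson_V"
proof (rule groupI)
  fix f assume f: "f \<in> carrier thompson_V"
  show "\<exists>g\<in>carrier thompson_V. g \<otimes>\<^bsub>thompson_V\<^esub> f = \<one>\<^bsub>thompson_V\<^esub>"
    using f by (intro bexI[of _ "inv_into UNIV f"])
      (auto simp: carrier_thompson_V bij_imp_bij_inv prefix_replacing_inv bij_is_inj)
qed (simp_all add: carrier_thompson_V bij_comp prefix_replacing_comp comp_assoc)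

interpretation V: group thompson_V
  by (rule group_thompson_V)

section \<open>Splitting the Cantor set\<close>

lemma suffix_1_build [simp]: "suffix (Suc 0) (a ## w) = w"
  by (rule ext) simp

text \<open>
  \<open>squeeze\<close> maps the Cantor set onto the complement of \<open>cone [True, True]\<close> and fixes
  \<open>cone [False]\<close> pointwise; iterating it splits off further pieces.
\<close>

definition squeeze :: "(nat \<Rightarrow> bool) \<Rightarrow> (nat \<Rightarrow> bool)" where
  "squeeze x = (if x 0 then True ## False ## suffix 1 x else x)"

lemma squeeze_simps [simp]:
  "squeeze (False ## w) = False ## w"
  "squeeze (True ## w) = True ## False ## w"
  by (simp_all add: squeeze_def)

lemma squeeze_eq_iff [simp]: "squeeze x = squeeze y \<longleftrightarrow> x = y"
  by (cases x rule: build_cases; cases y rule: build_cases) auto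

lemma squeeze_neq [simp]: "squeeze x \<noteq> True ## True ## y" "True ## True ## y \<noteq> squeeze x"
  by (cases x rule: build_cases; simp)+

lemma squeeze_range: "(\<exists>x. y = squeeze x) \<or> (\<exists>x. y = True ## True ## x)"
proof (cases y rule: build_cases)
  case (False w)
  then show ?thesis by (metis squeeze_simps(1))
next
  case (True w)
  then show ?thesis by (cases w rule: build_cases) (metis squeeze_simps(2))+
qed

lemma prefix_replacing_squeeze: "prefix_replacing squeeze"
proof (rule prefix_replacing_charts[where c = "(##)"
      and h = "\<lambda>b. if b then (##) True \<circ> (##) False else (##) False"])
  show "\<exists>b w. y = b ## w" for y :: "nat \<Rightarrow> bool"
    by (metis build_cases)
  show "prefix_replacing (if b then (##) True \<circ> (##) False else (##) False)" for b
    by (simp add: prefix_replacing_comp)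
  show "squeeze (b ## x) = (if b then (##) True \<circ> (##) False else (##) False) x" for b x
    by (cases b) simp_all
qed simp

text \<open>
  The maps \<open>split_chart k i\<close> for \<open>i \<le> k\<close> identify the Cantor set with the \<open>k + 1\<close> pieces of a partition
  of itself. Counting pieces from \<open>k = 0\<close> reflects that at least one piece is needed. Piece \<open>0\<close>
  contains \<open>cone [False]\<close>, with its points in their original places.
\<close>

primrec split_chart :: "nat \<Rightarrow> nat \<Rightarrow> (nat \<Rightarrow> bool) \<Rightarrow> (nat \<Rightarrow> bool)" where
  "split_chart 0 i x = x"
| "split_chart (Suc k) i x = (if i = Suc k then True ## True ## x else squeeze (split_chart k i x))"

lemma split_chart_eq_iff:
  "i \<le> k \<Longrightarrow> j \<le> k \<Longrightarrow> split_chart k i x = split_chart k j y \<longleftrightarrow> i = j \<and> x = y"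
  by (induction k) (auto simp: le_Suc_eq)

lemma split_chart_surj: "\<exists>i\<le>k. \<exists>x. y = split_chart k i x"
proof (induction k arbitrary: y)
  case (Suc k)
  from squeeze_range[of y] show ?case
  proof
    assume "\<exists>x. y = squeeze x"
    then obtain x where x: "y = squeeze x" ..
    obtain i z where "i \<le> k" "x = split_chart k i z" using Suc.IH by blast
    then show ?thesis
      by (intro exI[of _ i] conjI exI[of _ z]) (auto simp: x)
  next
    assume "\<exists>x. y = True ## True ## x"
    then show ?thesis by (intro exI[of _ "Suc k"]) auto
  qed
qed simp

lemma split_chart_fixes: "split_chart k 0 (False ## w) = False ## w"
  by (induction k) auto

lemma prefix_replacing_split_chart: "prefix_replacing (split_chart k i)"
proof (induction k)
  case 0
  have "split_chart 0 i = id" by (rule ext) simp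
  then show ?case by simp
next
  case (Suc k)
  have "split_chart (Suc k) i = (if i = Suc k then (##) True \<circ> (##) True else squeeze \<circ> split_chart k i)"
    by (rule ext) simp
  then show ?case
    using Suc by (simp add: prefix_replacing_comp prefix_replacing_squeeze)
qed

section \<open>Demonstrative representations\<close>

definition demonstrative ::
    "('g \<Rightarrow> (nat \<Rightarrow> bool) \<Rightarrow> (nat \<Rightarrow> bool)) \<Rightarrow> ('g, 'm) monoid_scheme \<Rightarrow> (nat \<Rightarrow> bool) set \<Rightarrow> bool" where
  "demonstrative \<phi> G A \<longleftrightarrow>
     \<phi> \<in> hom G thompson_V \<and> (\<forall>g\<in>carrier G - {\<one>\<^bsub>G\<^esub>}. \<phi> g ` A \<inter> A = {})"

text \<open>
  The cone is fixed once and for all, so that constructions on different groups can be combined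
  without adjusting it.
\<close>

definition demonstrable :: "('g, 'm) monoid_scheme \<Rightarrow> bool" where
  "demonstrable G \<longleftrightarrow> (\<exists>\<phi>. demonstrative \<phi> G (cone [False]))"

lemma demonstrable_pullback:
  assumes "demonstrable H" "f \<in> hom G H" 
    and "\<And>g. g \<in> carrier G \<Longrightarrow> g \<noteq> \<one>\<^bsub>G\<^esub> \<Longrightarrow> f g \<noteq> \<one>\<^bsub>H\<^esub>"
  shows "demonstrable G"
proof -
  obtain \<phi> where "demonstrative \<phi> H (cone [False])"
    using assms(1) by (auto simp: demonstrable_def)
  moreover from this have "\<phi> \<circ> f \<in> hom G thompson_V"
    using assms(2) hom_compose by (auto simp: demonstrative_def)
  moreover have "f g \<in> carrier H" if "g \<in> carrier G" for g
    using assms(2) that by (rule hom_in_carrier)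
  ultimately have "demonstrative (\<phi> \<circ> f) G (cone [False])"
    using assms(3) by (auto simp: demonstrative_def)
  then show ?thesis by (auto simp: demonstrable_def)
qed

lemma demonstrable_iso:
  assumes "group G" "group H" "G \<cong> H" "demonstrable H"
  shows "demonstrable G"
proof -
  obtain f where f: "f \<in> hom G H" "bij_betw f (carrier G) (carrier H)"
    using assms(3) by (auto simp: is_iso_def iso_def)
  show ?thesis
  proof (rule demonstrable_pullback[OF assms(4) f(1)])
    show "f g \<noteq> \<one>\<^bsub>H\<^esub>" if "g \<in> carrier G" "g \<noteq> \<one>\<^bsub>G\<^esub>" for g
      using that f assms(1,2) hom_one[OF f(1) assms(1,2)]
      by (metis bij_betw_imp_inj_on group.is_monoid inj_onD monoid.one_closed)
  qed
qed

text \<open>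
  One construction serves for finite groups and for products of a finite group with a
  demonstrable one. The pieces \<open>c x\<close> of the Cantor set are indexed by \<open>x\<close> in \<open>F\<close>, and \<open>g\<close> acts by
  sending the point with coordinate \<open>y\<close> in piece \<open>x\<close> to the point with coordinate \<open>b g y\<close> in piece
  \<open>a g \<otimes> x\<close>. The cone \<open>cone [False]\<close> lies in the piece of the identity: \<open>g\<close> moves it to another piece
  unless \<open>a g\<close> is the identity, and in that case \<open>b g\<close> moves it off itself within its piece.
\<close>

lemma demonstrable_finite_extension:
  assumes G: "group G" and F: "group F" "finite (carrier F)"
    and a: "a \<in> hom G F" and b: "b \<in> hom G thompson_V"
    and ab: "\<And>g. g \<in> carrier G \<Longrightarrow> g \<noteq> \<one>\<^bsub>G\<^esub> \<Longrightarrow> a g = \<one>\<^bsub>F\<^esub> \<Longrightarrow>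
               b g ` cone [False] \<inter> cone [False] = {}"
  shows "demonstrable G"
proof -
  interpret F: group F by (rule F(1))
  define k where "k = card (carrier F) - 1"
  have "card (carrier F - {\<one>\<^bsub>F\<^esub>}) = k"
    using F(2) by (simp add: k_def)
  then obtain e0 where e0: "bij_betw e0 (carrier F - {\<one>\<^bsub>F\<^esub>}) {1..k}"
    using F(2) finite_same_card_bij[of "carrier F - {\<one>\<^bsub>F\<^esub>}" "{1..k}"] by auto
  \<comment> \<open>The identity must get the number 0, the piece with the cone in place.\<close>
  define e where "e x = (if x = \<one>\<^bsub>F\<^esub> then 0 else e0 x)" for x
  have "bij_betw e (carrier F - {\<one>\<^bsub>F\<^esub>}) {1..k}"
    using e0 by (subst bij_betw_cong[of _ e e0]) (auto simp: e_def)
  moreover have "bij_betw e {\<one>\<^bsub>F\<^esub>} {0}"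
    by (auto simp: e_def bij_betw_def)
  ultimately have "bij_betw e ({\<one>\<^bsub>F\<^esub>} \<union> (carrier F - {\<one>\<^bsub>F\<^esub>})) ({0} \<union> {1..k})"
    by (intro bij_betw_combine) auto
  moreover have "{\<one>\<^bsub>F\<^esub>} \<union> (carrier F - {\<one>\<^bsub>F\<^esub>}) = carrier F" "{0} \<union> {1..k} = {..k}"
    by auto
  ultimately have e: "bij_betw e (carrier F) {..k}" by simp
  have e1: "e \<one>\<^bsub>F\<^esub> = 0" by (simp add: e_def)
  define c where "c x = split_chart k (e x)" for x
  have c_eq: "c x y = c x' y' \<longleftrightarrow> x = x' \<and> y = y'" if "x \<in> carrier F" "x' \<in> carrier F" for x x' y y'
  proof -
    have "e x \<le> k" "e x' \<le> k" using e that by (auto simp: bij_betw_def)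
    then show ?thesis
      using e that by (auto simp: c_def split_chart_eq_iff bij_betw_def inj_on_def)
  qed
  have c_surj: "\<exists>x\<in>carrier F. \<exists>y. z = c x y" for z
  proof -
    obtain i y where i: "i \<le> k" "z = split_chart k i y" using split_chart_surj by blast
    have "i \<in> e ` carrier F"
      using e i(1) by (simp add: bij_betw_def)
    then obtain x where "x \<in> carrier F" "e x = i"
      by blast
    then show ?thesis using i(2) by (auto simp: c_def)
  qed
  define \<phi> where "\<phi> g w = (THE z. \<exists>x\<in>carrier F. \<exists>y. w = c x y \<and> z = c (a g \<otimes>\<^bsub>F\<^esub> x) (b g y))" for g w
  have \<phi>: "\<phi> g (c x y) = c (a g \<otimes>\<^bsub>F\<^esub> x) (b g y)" if "x \<in> carrier F" for g x y
    unfolding \<phi>_def using that by (intro the_equality) (auto simp: c_eq)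
  have ag: "a g \<in> carrier F" if "g \<in> carrier G" for g
    using a that by (rule hom_in_carrier)
  have bg: "bij (b g)" "prefix_replacing (b g)" if "g \<in> carrier G" for g
    using hom_in_carrier[OF b that] by (simp_all add: carrier_thompson_V)
  have "\<phi> g \<in> carrier thompson_V" if g: "g \<in> carrier G" for g
  proof -
    have "prefix_replacing (\<phi> g)"
    \<comment> \<open>Indices outside \<open>F\<close> repeat the chart of the identity, because charts are indexed by a type.\<close>
    proof (rule prefix_replacing_charts[where c = "\<lambda>i. if i \<in> carrier F then c i else c \<one>\<^bsub>F\<^esub>"
          and h = "\<lambda>i. if i \<in> carrier F then c (a g \<otimes>\<^bsub>F\<^esub> i) \<circ> b g else c (a g) \<circ> b g"])
      show "\<exists>i x. y = (if i \<in> carrier F then c i else c \<one>\<^bsub>F\<^esub>) x" for y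
        using c_surj[of y] by metis
    qed (use g ag bg \<phi> in \<open>auto simp: c_def prefix_replacing_split_chart prefix_replacing_comp\<close>)
    moreover have "bij (\<phi> g)"
    proof (rule bijI)
      show "inj (\<phi> g)"
      proof (rule injI)
        fix u v assume eq: "\<phi> g u = \<phi> g v"
        obtain x y where x: "x \<in> carrier F" "u = c x y" using c_surj by blast
        obtain x' y' where x': "x' \<in> carrier F" "v = c x' y'" using c_surj by blast
        have "a g \<otimes>\<^bsub>F\<^esub> x = a g \<otimes>\<^bsub>F\<^esub> x' \<and> b g y = b g y'"
          using eq g x x' ag by (simp add: \<phi> c_eq)
        then show "u = v"
          using x x' ag[OF g] bg(1)[OF g] by (metis F.l_cancel bij_pointE)
      qed
      show "surj (\<phi> g)"
        unfolding surj_def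
      proof
        fix v
        obtain x y where x: "x \<in> carrier F" "v = c x y" using c_surj by blast
        obtain z where z: "y = b g z" using bg(1)[OF g] by (metis bij_pointE)
        have "\<phi> g (c (inv\<^bsub>F\<^esub> a g \<otimes>\<^bsub>F\<^esub> x) z) = v"
          using g x z ag[OF g] by (simp add: \<phi> F.m_assoc[symmetric])
        then show "\<exists>u. v = \<phi> g u" by blast
      qed
    qed
    ultimately show ?thesis by (simp add: carrier_thompson_V)
  qed
  moreover have "\<phi> (g \<otimes>\<^bsub>G\<^esub> g') = \<phi> g \<circ> \<phi> g'" if g: "g \<in> carrier G" "g' \<in> carrier G" for g g'
  proof
    fix w
    obtain x y where x: "x \<in> carrier F" "w = c x y" using c_surj by blast
    have "g \<otimes>\<^bsub>G\<^esub> g' \<in> carrier G"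
      using G g by (simp add: group.is_monoid monoid.m_closed)
    then show "\<phi> (g \<otimes>\<^bsub>G\<^esub> g') w = (\<phi> g \<circ> \<phi> g') w"
      using g x ag by (simp add: \<phi> F.m_assoc hom_mult[OF a] hom_mult[OF b])
  qed
  ultimately have "\<phi> \<in> hom G thompson_V"
    by (intro homI) auto
  moreover have "\<phi> g ` cone [False] \<inter> cone [False] = {}" if g: "g \<in> carrier G" "g \<noteq> \<one>\<^bsub>G\<^esub>" for g
  proof -
    have c1: "c \<one>\<^bsub>F\<^esub> (False ## w) = False ## w" for w
      by (simp add: c_def e1 split_chart_fixes)
    have "\<phi> g (False ## w) \<noteq> False ## w'" for w w'
    proof
      assume eq: "\<phi> g (False ## w) = False ## w'"
      have "\<phi> g (c \<one>\<^bsub>F\<^esub> (False ## w)) = c (a g) (b g (False ## w))"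
        using ag[OF g(1)] by (simp add: \<phi>)
      then have "c (a g) (b g (False ## w)) = c \<one>\<^bsub>F\<^esub> (False ## w')"
        using eq unfolding c1 by simp
      then have "a g = \<one>\<^bsub>F\<^esub>" "b g (False ## w) = False ## w'"
        using ag[OF g(1)] by (auto simp: c_eq)
      then have "False ## w' \<in> b g ` cone [False] \<inter> cone [False]"
        by (auto intro: image_eqI[of _ _ "False ## w"])
      then show False
        using ab[OF g] \<open>a g = \<one>\<^bsub>F\<^esub>\<close> by blast
    qed
    then show ?thesis by (auto simp: cone_def)
  qed
  ultimately show ?thesis
    by (auto simp: demonstrable_def demonstrative_def)
qed

section \<open>The infinite cyclic group\<close>

text \<open>
  The element of \<open>V\<close> given by \<open>0 \<mapsto> 100\<close>, \<open>10 \<mapsto> 101\<close>, \<open>110 \<mapsto> 0\<close>, \<open>111 \<mapsto> 11\<close> on prefixes. It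
  sends both \<open>cone [False]\<close> and \<open>cone [True, False]\<close> into the latter, so no positive power can bring
  a point of \<open>cone [False]\<close> back.
\<close>

definition shift :: "(nat \<Rightarrow> bool) \<Rightarrow> (nat \<Rightarrow> bool)" where
  "shift x =
    (if \<not> x 0 then True ## False ## False ## suffix 1 x
     else if \<not> x 1 then True ## False ## True ## suffix 2 x
     else if \<not> x 2 then False ## suffix 3 x
     else True ## True ## suffix 3 x)"

lemma shift_simps [simp]:
  "shift (False ## w) = True ## False ## False ## w"
  "shift (True ## False ## w) = True ## False ## True ## w"
  "shift (True ## True ## False ## w) = False ## w"
  "shift (True ## True ## True ## w) = True ## True ## w"
proof -
  have "suffix 2 (a ## b ## w) = w" "suffix 3 (a ## b ## c ## w) = w" for a b c
    by (rule ext, simp add: numeral_2_eq_2 numeral_3_eq_3)+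
  then show
    "shift (False ## w) = True ## False ## False ## w"
    "shift (True ## False ## w) = True ## False ## True ## w"
    "shift (True ## True ## False ## w) = False ## w"
    "shift (True ## True ## True ## w) = True ## True ## w"
    by (simp_all add: shift_def numeral_2_eq_2)
qed

lemma shift_cases:
  obtains (0) w where "x = False ## w" | (10) w where "x = True ## False ## w"
  | (110) w where "x = True ## True ## False ## w" | (111) w where "x = True ## True ## True ## w"
  by (metis build_cases)

lemma shift_in_V: "shift \<in> carrier thompson_V"
proof -
  have "inj shift"
  proof (rule injI)
    show "x = y" if "shift x = shift y" for x y
      using that by (cases x rule: shift_cases; cases y rule: shift_cases) auto
  qed
  moreover have "\<exists>x. y = shift x" for y
  proof (cases y rule: build_cases)
    case (False w)
    then show ?thesis by (metis shift_simps(3))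
  next
    case (True w)
    then show ?thesis
      by (metis shift_simps(1,2,4) build_cases)
  qed
  moreover have "prefix_replacing shift"
    unfolding prefix_replacing_def
  proof
    fix x
    show "\<exists>u v. x \<in> cone u \<and> (\<forall>w. shift (u \<frown> w) = v \<frown> w)"
    proof (cases x rule: shift_cases)
      case 0
      then show ?thesis
        by (intro exI[of _ "[False]"] exI[of _ "[True, False, False]"]) simp
    next
      case 10
      then show ?thesis
        by (intro exI[of _ "[True, False]"] exI[of _ "[True, False, True]"]) simp
    next
      case 110
      then show ?thesis
        by (intro exI[of _ "[True, True, False]"] exI[of _ "[False]"]) simp
    next
      case 111
      then show ?thesis
        by (intro exI[of _ "[True, True, True]"] exI[of _ "[True, True]"]) simp
    qed
  qed
  ultimately show ?thesis
    by (auto simp: carrier_thompson_V intro!: bijI)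
qed

text \<open>
  A return to the cone under a negative power would be a return under the opposite positive power,
  so wandering in the positive direction suffices.
\<close>

lemma demonstrable_integer_group: "demonstrable integer_group"
proof -
  define \<phi> :: "int \<Rightarrow> _" where "\<phi> k = shift [^]\<^bsub>thompson_V\<^esub> k" for k
  have add: "\<phi> (k + l) = \<phi> k \<circ> \<phi> l" for k l
    using shift_in_V by (simp add: \<phi>_def V.int_pow_mult)
  have wander: "(shift [^]\<^bsub>thompson_V\<^esub> n) x \<in> cone [True, False]"
    if "x \<in> cone [True, False]" for n :: nat and x
    using that
  proof (induction n arbitrary: x)
    case (Suc n)
    then have "shift x \<in> cone [True, False]"
      by (cases x rule: shift_cases) auto
    then show ?case using Suc.IH by simp
  qed simp
  have pos: "\<phi> k x \<noteq> y" if "k > 0" "x \<in> cone [False]" "y \<in> cone [False]" for k x y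
  proof -
    obtain n where n: "k = int (Suc n)"
      using \<open>k > 0\<close> by (metis gr0_implies_Suc zero_less_imp_eq_int)
    have "\<phi> k x = (shift [^]\<^bsub>thompson_V\<^esub> n) (shift x)"
      unfolding \<phi>_def n int_pow_int by simp
    moreover have "shift x \<in> cone [True, False]"
      using that(2) by (cases x rule: shift_cases) auto
    ultimately have "\<phi> k x \<in> cone [True, False]"
      using wander by simp
    then show ?thesis using that(3) by (auto simp: cone_def)
  qed
  have "\<phi> k x \<noteq> y" if k: "k \<noteq> 0" and x: "x \<in> cone [False]" and y: "y \<in> cone [False]" for k x y
  proof (cases "k > 0")
    case False
    have "\<phi> (- k) (\<phi> k x) = x"
      using add[of "- k" k] by (simp add: \<phi>_def fun_eq_iff)
    moreover have "\<phi> (- k) y \<noteq> x"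
      using pos[OF _ y x] False k by simp
    ultimately show ?thesis by auto
  qed (use pos x y in blast)
  moreover have "\<phi> \<in> hom integer_group thompson_V"
    using add shift_in_V by (auto simp: hom_def \<phi>_def)
  ultimately have "demonstrative \<phi> integer_group (cone [False])"
    unfolding demonstrative_def by auto
  then show ?thesis by (auto simp: demonstrable_def)
qed

section \<open>The rationals modulo one\<close>

text \<open>
  The pieces of stage \<open>n\<close> form a cycle of length \<open>fact n\<close>; \<open>chart n j\<close> parametrises the piece in position
  \<open>j\<close>, where \<open>j\<close> may be any integer and counts modulo \<open>fact n\<close>. Position \<open>j\<close> of stage \<open>n + 1\<close> lies in
  position \<open>j div (n + 1)\<close> of stage \<open>n\<close>: thus \<open>n + 1\<close> small steps make one large step, just as
  \<open>(n + 1) / (n + 1)! = 1 / n!\<close>.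
\<close>

primrec chart :: "nat \<Rightarrow> int \<Rightarrow> (nat \<Rightarrow> bool) \<Rightarrow> (nat \<Rightarrow> bool)" where
  "chart 0 j x = x"
| "chart (Suc n) j x = chart n (j div int (Suc n)) (split_chart n (nat (j mod int (Suc n))) x)"

lemma cong_mult_iff_div_mod:
  assumes "m > (0::int)"
  shows "[i = j] (mod m * k) \<longleftrightarrow> [i div m = j div m] (mod k) \<and> i mod m = j mod m"
proof -
  have "m * k dvd m * (i div m - j div m) + (i mod m - j mod m) \<longleftrightarrow>
      k dvd i div m - j div m \<and> i mod m = j mod m"
  proof
    assume d: "m * k dvd m * (i div m - j div m) + (i mod m - j mod m)"
    then have "m dvd i mod m - j mod m"
      by (metis dvd_add_right_iff dvd_mult_left dvd_triv_left)
    then have "i mod m = j mod m"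
      by (metis mod_eq_dvd_iff mod_mod_trivial)
    then show "k dvd i div m - j div m \<and> i mod m = j mod m"
      using d assms by simp
  qed auto
  moreover have "m * (i div m - j div m) + (i mod m - j mod m) = i - j"
    by (simp add: right_diff_distrib) (metis add_diff_add mult_div_mod_eq)
  ultimately show ?thesis
    by (simp add: cong_iff_dvd_diff)
qed

lemma chart_eq_iff: "chart n i x = chart n j y \<longleftrightarrow> [i = j] (mod fact n) \<and> x = y"
proof (induction n arbitrary: i j x y)
  case (Suc n)
  have "nat (l mod int (Suc n)) \<le> n" for l
    by (simp add: nat_le_iff) (smt (verit) pos_mod_bound of_nat_0_le_iff)
  moreover have "nat (i mod int (Suc n)) = nat (j mod int (Suc n)) \<longleftrightarrow> i mod int (Suc n) = j mod int (Suc n)"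
    by (simp add: nat_eq_iff)
  moreover have "(fact (Suc n) :: int) = int (Suc n) * fact n"
    by simp
  ultimately show ?case
    using Suc.IH cong_mult_iff_div_mod[of "int (Suc n)" i j "fact n"]
    by (simp only: chart.simps split_chart_eq_iff) auto
qed simp

lemma chart_surj: "\<exists>j x. y = chart n j x"
proof (induction n)
  case (Suc n)
  then obtain j x where y: "y = chart n j x" by blast
  obtain i z where i: "i \<le> n" "x = split_chart n i z" using split_chart_surj by blast
  have "chart (Suc n) (int (Suc n) * j + int i) z = y"
    using i by (simp add: y del: of_nat_Suc)
  then show ?case by metis
qed simp

lemma chart_fixes: "chart n 0 (False ## w) = False ## w"
  by (induction n) (auto simp: split_chart_fixes)

lemma prefix_replacing_chart: "prefix_replacing (chart n j)"
proof (induction n arbitrary: j)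
  case 0
  have "chart 0 j = id" by (rule ext) simp
  then show ?case by simp
next
  case (Suc n)
  have "chart (Suc n) j =
      chart n (j div int (Suc n)) \<circ> split_chart n (nat (j mod int (Suc n)))"
    by (rule ext) simp
  then show ?case
    using Suc by (simp only: prefix_replacing_comp prefix_replacing_split_chart)
qed

definition rotate_charts :: "nat \<Rightarrow> int \<Rightarrow> (nat \<Rightarrow> bool) \<Rightarrow> (nat \<Rightarrow> bool)" where
  "rotate_charts n p y = (THE z. \<exists>j x. y = chart n j x \<and> z = chart n (j + p) x)"

lemma rotate_chart [simp]: "rotate_charts n p (chart n j x) = chart n (j + p) x"
  unfolding rotate_charts_def
proof (rule the_equality)
  fix z assume "\<exists>j' x'. chart n j x = chart n j' x' \<and> z = chart n (j' + p) x'"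
  then obtain j' where "[j' = j] (mod fact n)" "z = chart n (j' + p) x"
    by (auto simp: chart_eq_iff cong_sym_eq)
  then show "z = chart n (j + p) x"
    by (simp add: chart_eq_iff cong_add_rcancel)
qed blast

text \<open>
  Equations between rotations are verified on the charts, which cover the Cantor set.
\<close>

lemma rotate_charts_eqI:
  assumes "\<And>j x. f (chart n j x) = chart n (j + p) x"
  shows "rotate_charts n p = f"
proof
  fix y
  show "rotate_charts n p y = f y"
    using chart_surj[of y n] assms by auto
qed

lemma rotate_charts_0 [simp]: "rotate_charts n 0 = id"
  by (rule rotate_charts_eqI) simp

lemma rotate_charts_add: "rotate_charts n (p + q) = rotate_charts n p \<circ> rotate_charts n q"
  by (rule rotate_charts_eqI) (simp add: algebra_simps)

lemma rotate_charts_in_V: "rotate_charts n p \<in> carrier thompson_V"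
proof -
  have "bij (rotate_charts n p)"
    by (rule o_bij[of "rotate_charts n (- p)"]) (simp_all flip: rotate_charts_add)
  moreover have "prefix_replacing (rotate_charts n p)"
    by (rule prefix_replacing_charts[where c = "chart n" and h = "\<lambda>j. chart n (j + p)"])
      (simp_all add: chart_surj prefix_replacing_chart)
  ultimately show ?thesis by (simp add: carrier_thompson_V)
qed

text \<open>
  The rotation by \<open>p / n!\<close> is the same at all stages from \<open>n\<close> on: adding \<open>(n + 1) * p\<close> to a position
  of stage \<open>n + 1\<close> adds \<open>p\<close> to the position of the surrounding piece and keeps the place in it.
\<close>

lemma rotate_charts_Suc: "rotate_charts (Suc n) (int (Suc n) * p) = rotate_charts n p"
  by (rule rotate_charts_eqI) (simp add: add.commute del: of_nat_Suc)

lemma rotate_charts_refine: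
  "n \<le> m \<Longrightarrow> rotate_charts m (fact m div fact n * p) = rotate_charts n p"
proof (induction m rule: dec_induct)
  case (step m)
  have "(fact (Suc m) div fact n * p :: int) = int (Suc m) * (fact m div fact n * p)"
    using step.hyps by (simp add: fact_dvd div_mult_swap)
  then show ?case
    using step.IH by (simp only: rotate_charts_Suc)
qed simp

lemma rotate_charts_cong:
  assumes "(of_int p / fact n :: rat) = of_int q / fact m"
  shows "rotate_charts n p = rotate_charts m q"
proof -
  let ?k = "max n m"
  obtain c d :: int where c: "fact ?k = fact n * c" and d: "fact ?k = fact m * d"
    by (meson dvdE fact_dvd max.cobounded1 max.cobounded2)
  have "of_int (p * fact m) = (of_int (q * fact n) :: rat)"
    using assms by (simp add: field_simps)
  then have pq: "p * fact m = q * fact n"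
    by (simp only: of_int_eq_iff)
  have "(fact n * fact m) * (c * p) = (fact n * c) * (p * fact m)"
    by (simp add: mult_ac)
  also have "\<dots> = (fact n * fact m) * (d * q)"
    unfolding pq c[symmetric] d by (simp add: mult_ac)
  finally have "c * p = d * q" by simp
  then have "fact ?k div fact n * p = fact ?k div fact m * q"
    by (simp add: c) (simp add: d flip: c)
  then show ?thesis
    by (metis rotate_charts_refine max.cobounded1 max.cobounded2)
qed

lemma rat_over_fact:
  fixes r :: rat
  obtains n p where "r = of_int p / fact n"
proof -
  obtain a b where r: "r = of_int a / of_int b" and "b > 0"
    by (metis quotient_of_denom_pos quotient_of_div surj_pair)
  then have "b dvd fact (nat b)"
    using dvd_fact[of "nat b" "nat b"] by (metis One_nat_def Suc_le_eq int_nat_eq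
        int_dvd_int_iff le_refl less_imp_le of_nat_fact zero_less_nat_eq)
  then obtain c where c: "fact (nat b) = b * c" ..
  have "c \<noteq> 0" using c fact_nonzero[of "nat b", where 'a = int] by auto
  moreover have "(fact (nat b) :: rat) = of_int b * of_int c"
    by (metis c of_int_fact of_int_mult)
  ultimately have "r = of_int (a * c) / fact (nat b)"
    using r by simp
  then show ?thesis by (rule that)
qed

text \<open>
  All representations of \<open>r\<close> with a factorial denominator give the same rotation, so any may be chosen.
\<close>

definition rat_rotation :: "rat \<Rightarrow> (nat \<Rightarrow> bool) \<Rightarrow> (nat \<Rightarrow> bool)" where
  "rat_rotation r = (SOME f. \<exists>n p. r = of_int p / fact n \<and> f = rotate_charts n p)"

lemma rat_rotation_eq:
  assumes "r = of_int p / fact n"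
  shows "rat_rotation r = rotate_charts n p"
  unfolding rat_rotation_def
  by (rule some_equality) (use assms rotate_charts_cong in blast)+

lemma rat_rotation_in_V: "rat_rotation r \<in> carrier thompson_V"
  using rat_over_fact[of r] rat_rotation_eq rotate_charts_in_V by metis

lemma rat_rotation_add: "rat_rotation (r + s) = rat_rotation r \<circ> rat_rotation s"
proof -
  obtain n p where r: "r = of_int p / fact n" by (rule rat_over_fact)
  obtain m q where s: "s = of_int q / fact m" by (rule rat_over_fact)
  let ?k = "max n m"
  obtain c d :: int where c: "fact ?k = fact n * c" and d: "fact ?k = fact m * d"
    by (meson dvdE fact_dvd max.cobounded1 max.cobounded2)
  have c': "(fact ?k :: rat) = fact n * of_int c"
    by (metis c of_int_fact of_int_mult)
  have d': "(fact ?k :: rat) = fact m * of_int d"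
    by (metis d of_int_fact of_int_mult)
  have "of_int c \<noteq> (0 :: rat)" "of_int d \<noteq> (0 :: rat)"
    using c' d' fact_nonzero[of ?k, where 'a = rat] by auto
  then have r': "r = of_int (p * c) / fact ?k" and s': "s = of_int (q * d) / fact ?k"
    using r s c' d' by (simp, metis (no_types, lifting) mult_divide_mult_cancel_right of_int_mult)+
  have "r + s = of_int (p * c + q * d) / fact ?k"
    unfolding r' s' by (simp add: add_divide_distrib)
  then show ?thesis
    by (simp only: rat_rotation_eq[OF r'] rat_rotation_eq[OF s'] rat_rotation_eq rotate_charts_add)
qed

lemma rat_rotation_Ints: "r \<in> \<int> \<Longrightarrow> rat_rotation r = id"
  by (auto elim!: Ints_cases intro!: trans[OF rat_rotation_eq[where n = 0]] rotate_charts_eqI)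

text \<open>
  At every stage the cone lies in position \<open>0\<close>, with its points in place, and a rotation by \<open>p\<close> fixes
  that position only if \<open>fact n\<close> divides \<open>p\<close>.
\<close>

lemma rat_rotation_moves_cone:
  assumes "r \<notin> \<int>"
  shows "rat_rotation r ` cone [False] \<inter> cone [False] = {}"
proof -
  obtain n p where r: "r = of_int p / fact n" by (rule rat_over_fact)
  have "rat_rotation r (False ## w) \<noteq> False ## w'" for w w'
  proof
    assume "rat_rotation r (False ## w) = False ## w'"
    then have "rotate_charts n p (chart n 0 (False ## w)) = chart n 0 (False ## w')"
      unfolding chart_fixes rat_rotation_eq[OF r] .
    then have "fact n dvd p"
      by (simp add: chart_eq_iff cong_0_iff)
    then obtain c where "p = fact n * c" ..
    then have "r = of_int c" using r by simp
    then show False using assms by simp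
  qed
  then show ?thesis by (auto simp: cone_def)
qed

lemma rat_mod_int_group:
  shows group_rat_mod_int_group: "group rat_mod_int_group"
    and demonstrable_rat_mod_int_group: "demonstrable rat_mod_int_group"
proof -
  define Q :: "rat monoid" where "Q = \<lparr>carrier = UNIV, mult = (+), one = 0\<rparr>"
  have [simp]: "carrier Q = UNIV" "\<one>\<^bsub>Q\<^esub> = 0" "x \<otimes>\<^bsub>Q\<^esub> y = x + y" for x y
    by (simp_all add: Q_def)
  have "group Q"
    by (rule groupI) (auto simp: add.assoc intro: exI[of _ "- x" for x])
  then interpret group_hom Q thompson_V rat_rotation
    by (simp add: group_hom_def group_hom_axioms_def group_thompson_V hom_def
        rat_rotation_in_V rat_rotation_add)
  have "rat_rotation r \<noteq> id" if "r \<notin> \<int>" for r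
  proof
    assume "rat_rotation r = id"
    then have "cone [False] = {}"
      using rat_rotation_moves_cone[OF that] by simp
    then show False by (metis conc_in_cone empty_iff)
  qed
  \<comment> \<open>The kernel is exactly \<open>\<int>\<close>, so the action descends to the quotient.\<close>
  then have ker: "kernel Q thompson_V rat_rotation = \<int>"
    using rat_rotation_Ints by (auto simp: kernel_def)
  have "the_elem (rat_rotation ` C) ` cone [False] \<inter> cone [False] = {}"
    if C: "C \<in> carrier (Q Mod \<int>)" "C \<noteq> \<int>" for C
  proof -
    obtain r where r: "C = (\<lambda>z. z + r) ` \<int>"
      using C(1) by (auto simp: FactGroup_def RCOSETS_def r_coset_def)
    have "rat_rotation ` C = (\<lambda>_. rat_rotation r) ` (\<int> :: rat set)"
      unfolding r image_image
      by (rule image_cong) (simp_all add: rat_rotation_add rat_rotation_Ints)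
    then have "the_elem (rat_rotation ` C) = rat_rotation r"
      by (simp add: image_constant_conv) (use Ints_0 in blast)
    moreover have "r \<notin> \<int>"
    proof
      assume "r \<in> \<int>"
      then have "C = \<int>"
        unfolding r by (auto intro!: image_eqI[of _ _ "x - r" for x])
      then show False using C(2) by blast
    qed
    ultimately show ?thesis by (simp add: rat_rotation_moves_cone)
  qed
  then have "demonstrative (\<lambda>C. the_elem (rat_rotation ` C)) (Q Mod \<int>) (cone [False])"
    using FactGroup_hom unfolding ker demonstrative_def by (simp add: FactGroup_def)
  moreover have "rat_mod_int_group = Q Mod \<int>"
    by (simp add: rat_mod_int_group_def Q_def)
  ultimately show "demonstrable rat_mod_int_group" "group rat_mod_int_group"
    using normal.factorgroup_is_group[OF normal_kernel] unfolding ker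
    by (auto simp: demonstrable_def)
qed

section \<open>Demonstrative representations for the whole class\<close>

lemma class_A_nat_group: "class_A_nat G \<Longrightarrow> group G"
  by (induction rule: class_A_nat.induct) (auto intro: subgroup.subgroup_is_group)

lemma class_A_nat_demonstrable: "class_A_nat G \<Longrightarrow> demonstrable G"
proof (induction rule: class_A_nat.induct)
  case (finite G)
  show ?case
    by (rule demonstrable_finite_extension[OF finite(1) finite, of id "\<lambda>_. id"])
      (auto simp: hom_def carrier_thompson_V)
next
  case (integers G)
  then show ?case
    using demonstrable_iso demonstrable_integer_group group_integer_group by blast
next
  case (rat_mod_int G)
  then show ?case
    using demonstrable_iso demonstrable_rat_mod_int_group group_rat_mod_int_group by blast
next
  case (isomorphism H G)
  then show ?case
    using demonstrable_iso class_A_nat_group by blast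
next
  case (subgroup H S)
  have "S \<subseteq> carrier H" using subgroup.hyps(2) by (rule subgroup.subset)
  then have "id \<in> hom (H\<lparr>carrier := S\<rparr>) H"
    by (auto simp: hom_def)
  with subgroup.IH show ?case
    by (rule demonstrable_pullback) simp
next
  case (product F H G)
  have F: "group F" and H: "group H"
    using product.hyps class_A_nat_group by blast+
  obtain f where f: "f \<in> hom G (F \<times>\<times> H)" "bij_betw f (carrier G) (carrier (F \<times>\<times> H))"
    using \<open>G \<cong> F \<times>\<times> H\<close> by (auto simp: is_iso_def iso_def)
  obtain \<phi> where \<phi>: "demonstrative \<phi> H (cone [False])"
    using product.IH by (auto simp: demonstrable_def)
  have fc: "f g \<in> carrier F \<times> carrier H" if "g \<in> carrier G" for g
    using hom_in_carrier[OF f(1) that] by simp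
  show ?case
  proof (rule demonstrable_finite_extension[OF \<open>group G\<close> F \<open>finite (carrier F)\<close>,
        of "fst \<circ> f" "\<phi> \<circ> (snd \<circ> f)"])
    show "fst \<circ> f \<in> hom G F"
      using f(1) hom_pairwise by blast
    show "\<phi> \<circ> (snd \<circ> f) \<in> hom G thompson_V"
      using f(1) hom_pairwise[of f G F H] \<phi> hom_compose[of "snd \<circ> f" G H \<phi> thompson_V]
      by (simp add: demonstrative_def)
    fix g assume g: "g \<in> carrier G" "g \<noteq> \<one>\<^bsub>G\<^esub>" "(fst \<circ> f) g = \<one>\<^bsub>F\<^esub>"
    have "f g \<noteq> f \<one>\<^bsub>G\<^esub>"
      using f(2) g \<open>group G\<close> by (auto simp: bij_betw_def inj_on_def group.is_monoid)
    moreover have "f \<one>\<^bsub>G\<^esub> = (\<one>\<^bsub>F\<^esub>, \<one>\<^bsub>H\<^esub>)"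
      using hom_one[OF f(1) \<open>group G\<close> DirProd_group[OF F H]] by simp
    ultimately have "snd (f g) \<noteq> \<one>\<^bsub>H\<^esub>"
      using g(3) by (auto simp: prod_eq_iff)
    then show "(\<phi> \<circ> (snd \<circ> f)) g ` cone [False] \<inter> cone [False] = {}"
      using \<phi> fc[OF g(1)] by (auto simp: demonstrative_def mem_Times_iff)
  qed
qed

lemma class_A_demonstrable: "class_A G \<Longrightarrow> demonstrable G"
  using class_A_nat_demonstrable class_A_nat_group demonstrable_iso
  unfolding class_A_def by blast

section \<open>Homomorphisms out of a free product\<close>

text \<open>
  The homomorphism from the free product into \<open>L\<close> that is given by \<open>\<phi>\<close> and \<open>\<psi>\<close> on the factors.
\<close>

definition free_hom ::
    "('a \<Rightarrow> 'c) \<Rightarrow> ('b \<Rightarrow> 'c) \<Rightarrow> ('c, 'k) monoid_scheme \<Rightarrow> ('a + 'b) list \<Rightarrow> 'c" where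
  "free_hom \<phi> \<psi> L w = foldr (\<lambda>x y. case_sum \<phi> \<psi> x \<otimes>\<^bsub>L\<^esub> y) w \<one>\<^bsub>L\<^esub>"

lemma free_hom_simps [simp]:
  "free_hom \<phi> \<psi> L [] = \<one>\<^bsub>L\<^esub>"
  "free_hom \<phi> \<psi> L (x # w) = case_sum \<phi> \<psi> x \<otimes>\<^bsub>L\<^esub> free_hom \<phi> \<psi> L w"
  by (simp_all add: free_hom_def)

lemma word_value_eq_free_hom: "word_value G = free_hom id id G"
  by (rule ext) (simp add: word_value_def free_hom_def)

lemma free_product_simps [simp]:
  "carrier (free_product G H) = reduced_words G H"
  "u \<otimes>\<^bsub>free_product G H\<^esub> v = foldr (letter_mult G H) u v"
  "\<one>\<^bsub>free_product G H\<^esub> = []"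
  by (simp_all add: free_product_def)

lemma reduced_words_eq_lists:
  "reduced_words G H = {w \<in> lists (letters G H). successively (\<lambda>x y. isl x \<noteq> isl y) w}"
  by (auto simp: reduced_words_def)

lemma reduced_words_Nil [simp]: "[] \<in> reduced_words G H"
  by (simp add: reduced_words_def)

lemma reduced_words_Cons:
  "x # w \<in> reduced_words G H \<longleftrightarrow>
     x \<in> letters G H \<and> w \<in> reduced_words G H \<and> (w = [] \<or> isl x \<noteq> isl (hd w))"
  by (cases w) (auto simp: reduced_words_def)

lemma letters_iff [simp]:
  "Inl g \<in> letters G H \<longleftrightarrow> g \<in> carrier G \<and> g \<noteq> \<one>\<^bsub>G\<^esub>"
  "Inr h \<in> letters G H \<longleftrightarrow> h \<in> carrier H \<and> h \<noteq> \<one>\<^bsub>H\<^esub>"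
  by (auto simp: letters_def)

lemma letter_mult_reduced:
  assumes "group G" "group H" "x \<in> letters G H" "w \<in> reduced_words G H"
  shows "letter_mult G H x w \<in> reduced_words G H"
proof (cases w)
  case Nil
  then show ?thesis using assms(3) by (cases x) (auto simp: reduced_words_Cons)
next
  case (Cons y w')
  interpret G: group G by fact
  interpret H: group H by fact
  show ?thesis
    using assms(3,4) unfolding Cons
    by (cases x; cases y) (auto simp: reduced_words_Cons)
qed

lemma foldr_letter_mult_reduced:
  assumes "group G" "group H"
  shows "set u \<subseteq> letters G H \<Longrightarrow> v \<in> reduced_words G H \<Longrightarrow>
    foldr (letter_mult G H) u v \<in> reduced_words G H"
  by (induction u) (auto intro: letter_mult_reduced[OF assms])

context
  fixes G :: "('a, 'm) monoid_scheme" and H :: "('b, 'n) monoid_scheme"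
    and L :: "('c, 'k) monoid_scheme" and \<phi> \<psi>
  assumes G: "group G" and H: "group H" and L: "group L"
    and \<phi>: "\<phi> \<in> hom G L" and \<psi>: "\<psi> \<in> hom H L"
begin

interpretation G: group G by (rule G)
interpretation H: group H by (rule H)
interpretation L: group L by (rule L)

lemma case_sum_closed: "x \<in> letters G H \<Longrightarrow> case_sum \<phi> \<psi> x \<in> carrier L"
  using hom_in_carrier[OF \<phi>] hom_in_carrier[OF \<psi>] by (cases x) auto

lemma free_hom_closed: "set w \<subseteq> letters G H \<Longrightarrow> free_hom \<phi> \<psi> L w \<in> carrier L"
  by (induction w) (auto simp: case_sum_closed)

lemma free_hom_letter_mult:
  assumes x: "x \<in> letters G H" and w: "set w \<subseteq> letters G H"
  shows "free_hom \<phi> \<psi> L (letter_mult G H x w) = case_sum \<phi> \<psi> x \<otimes>\<^bsub>L\<^esub> free_hom \<phi> \<psi> L w"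
proof (cases w)
  case Nil
  then show ?thesis by (cases x) auto
next
  case (Cons y w')
  then have y: "y \<in> letters G H" and c: "free_hom \<phi> \<psi> L w' \<in> carrier L"
    using w free_hom_closed by auto
  have "\<phi> g \<otimes>\<^bsub>L\<^esub> (\<phi> g' \<otimes>\<^bsub>L\<^esub> free_hom \<phi> \<psi> L w') = \<phi> (g \<otimes>\<^bsub>G\<^esub> g') \<otimes>\<^bsub>L\<^esub> free_hom \<phi> \<psi> L w'"
    if "g \<in> carrier G" "g' \<in> carrier G" for g g'
    using that c by (simp add: hom_mult[OF \<phi>] hom_in_carrier[OF \<phi>] L.m_assoc)
  moreover have "\<psi> h \<otimes>\<^bsub>L\<^esub> (\<psi> h' \<otimes>\<^bsub>L\<^esub> free_hom \<phi> \<psi> L w') = \<psi> (h \<otimes>\<^bsub>H\<^esub> h') \<otimes>\<^bsub>L\<^esub> free_hom \<phi> \<psi> L w'"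
    if "h \<in> carrier H" "h' \<in> carrier H" for h h'
    using that c by (simp add: hom_mult[OF \<psi>] hom_in_carrier[OF \<psi>] L.m_assoc)
  ultimately show ?thesis
    using x y c hom_one[OF \<phi> G L] hom_one[OF \<psi> H L] unfolding Cons
    by (cases x; cases y) auto
qed

lemma free_hom_foldr:
  assumes "set u \<subseteq> letters G H" "v \<in> reduced_words G H"
  shows "free_hom \<phi> \<psi> L (foldr (letter_mult G H) u v) =
    free_hom \<phi> \<psi> L u \<otimes>\<^bsub>L\<^esub> free_hom \<phi> \<psi> L v"
  using assms(1)
proof (induction u)
  case Nil
  then show ?case
    using assms(2) free_hom_closed by (simp add: reduced_words_def)
next
  case (Cons x u)
  then have "foldr (letter_mult G H) u v \<in> reduced_words G H"
    using assms(2) by (simp add: foldr_letter_mult_reduced[OF G H])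
  then show ?case
    using Cons assms(2) free_hom_closed case_sum_closed
    by (simp add: free_hom_letter_mult reduced_words_def L.m_assoc)
qed

lemma free_hom_hom: "free_hom \<phi> \<psi> L \<in> hom (free_product G H) L"
  by (rule homI) (auto simp: reduced_words_def free_hom_closed free_hom_foldr)

text \<open>
  Associativity of the multiplication of reduced words would require a tedious case analysis of
  cancellations. It is instead inherited from \<open>L\<close> through an injective homomorphism.
\<close>

lemma group_free_product:
  assumes inj: "inj_on (free_hom \<phi> \<psi> L) (reduced_words G H)"
  shows "group (free_product G H)"
proof (rule groupI)
  let ?P = "free_product G H"
  note hm = hom_mult[OF free_hom_hom] and hc = hom_in_carrier[OF free_hom_hom]
  show closed: "u \<otimes>\<^bsub>?P\<^esub> v \<in> carrier ?P" if "u \<in> carrier ?P" "v \<in> carrier ?P" for u v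
    using that foldr_letter_mult_reduced[OF G H] by (simp add: reduced_words_def)
  show "u \<otimes>\<^bsub>?P\<^esub> v \<otimes>\<^bsub>?P\<^esub> w = u \<otimes>\<^bsub>?P\<^esub> (v \<otimes>\<^bsub>?P\<^esub> w)"
    if "u \<in> carrier ?P" "v \<in> carrier ?P" "w \<in> carrier ?P" for u v w
  proof (rule inj_onD[OF inj])
    show "free_hom \<phi> \<psi> L (u \<otimes>\<^bsub>?P\<^esub> v \<otimes>\<^bsub>?P\<^esub> w) = free_hom \<phi> \<psi> L (u \<otimes>\<^bsub>?P\<^esub> (v \<otimes>\<^bsub>?P\<^esub> w))"
      using that by (simp only: hm hc closed L.m_assoc)
    show "u \<otimes>\<^bsub>?P\<^esub> v \<otimes>\<^bsub>?P\<^esub> w \<in> reduced_words G H" "u \<otimes>\<^bsub>?P\<^esub> (v \<otimes>\<^bsub>?P\<^esub> w) \<in> reduced_words G H"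
      using that closed by (simp_all only: free_product_simps(1))
  qed
  show "\<exists>v\<in>carrier ?P. v \<otimes>\<^bsub>?P\<^esub> w = \<one>\<^bsub>?P\<^esub>" if w: "w \<in> carrier ?P" for w
  proof -
    have "\<exists>v\<in>carrier ?P. free_hom \<phi> \<psi> L v \<otimes>\<^bsub>L\<^esub> free_hom \<phi> \<psi> L w = \<one>\<^bsub>L\<^esub>"
      using w
    proof (induction w)
      case Nil
      then show ?case by (intro bexI[of _ "[]"]) simp_all
    next
      case (Cons x w)
      then have x: "x \<in> letters G H" and w: "w \<in> carrier ?P"
        by (auto simp: reduced_words_Cons)
      with Cons.IH obtain v where
        v: "v \<in> carrier ?P" "free_hom \<phi> \<psi> L v \<otimes>\<^bsub>L\<^esub> free_hom \<phi> \<psi> L w = \<one>\<^bsub>L\<^esub>"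
        by blast
      have "\<exists>x'\<in>letters G H. case_sum \<phi> \<psi> x' \<otimes>\<^bsub>L\<^esub> case_sum \<phi> \<psi> x = \<one>\<^bsub>L\<^esub>"
      proof (cases x)
        case (Inl g)
        then show ?thesis
          using x hom_one[OF \<phi> G L]
          by (intro bexI[of _ "Inl (inv\<^bsub>G\<^esub> g)"]) (auto simp flip: hom_mult[OF \<phi>])
      next
        case (Inr h)
        then show ?thesis
          using x hom_one[OF \<psi> H L]
          by (intro bexI[of _ "Inr (inv\<^bsub>H\<^esub> h)"]) (auto simp flip: hom_mult[OF \<psi>])
      qed
      then obtain x' where x': "x' \<in> letters G H" "case_sum \<phi> \<psi> x' \<otimes>\<^bsub>L\<^esub> case_sum \<phi> \<psi> x = \<one>\<^bsub>L\<^esub>"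
        by blast
      have x'P: "[x'] \<in> carrier ?P" using x'(1) by (simp add: reduced_words_Cons)
      have "free_hom \<phi> \<psi> L (v \<otimes>\<^bsub>?P\<^esub> [x']) = free_hom \<phi> \<psi> L v \<otimes>\<^bsub>L\<^esub> case_sum \<phi> \<psi> x'"
        using hm[OF v(1) x'P] case_sum_closed[OF x'(1)] by simp
      then have "free_hom \<phi> \<psi> L (v \<otimes>\<^bsub>?P\<^esub> [x']) \<otimes>\<^bsub>L\<^esub> free_hom \<phi> \<psi> L (x # w) =
          free_hom \<phi> \<psi> L v \<otimes>\<^bsub>L\<^esub> ((case_sum \<phi> \<psi> x' \<otimes>\<^bsub>L\<^esub> case_sum \<phi> \<psi> x) \<otimes>\<^bsub>L\<^esub> free_hom \<phi> \<psi> L w)"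
        using case_sum_closed[OF x'(1)] case_sum_closed[OF x] hc[OF v(1)] hc[OF w]
        by (simp add: L.m_assoc)
      also have "\<dots> = \<one>\<^bsub>L\<^esub>"
        using x'(2) v(2) hc[OF w] by simp
      finally show ?case
        using closed[OF v(1) x'P] by blast
    qed
    then obtain v where v: "v \<in> carrier ?P" "free_hom \<phi> \<psi> L (v \<otimes>\<^bsub>?P\<^esub> w) = free_hom \<phi> \<psi> L \<one>\<^bsub>?P\<^esub>"
      using hm w by auto
    then show ?thesis
      using inj_onD[OF inj v(2)] closed[OF v(1) w] by auto
  qed
qed auto

end

lemma free_factor_hom:
  assumes "group G" "group H"
  shows "(\<lambda>g. if g = \<one>\<^bsub>G\<^esub> then [] else [Inl g]) \<in> hom G (free_product G H)"
    and "(\<lambda>h. if h = \<one>\<^bsub>H\<^esub> then [] else [Inr h]) \<in> hom H (free_product G H)"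
  using assms[THEN group.is_monoid]
  by (auto simp: hom_def reduced_words_Cons monoid.m_closed monoid.l_one monoid.r_one)

text \<open>
  Reduced words over the two factors, seen as subgroups of the free product, are the reduced words
  over the original groups with every letter replaced by a one-letter word; multiplying such a word
  out undoes the replacement.
\<close>

lemma free_product_is_free_product_of:
  fixes G :: "('a, 'm) monoid_scheme" and H :: "('b, 'n) monoid_scheme"
  assumes G: "group G" and H: "group H" and P: "group (free_product G H)"
  shows "is_free_product_of (free_product G H)
    (insert [] ((\<lambda>g. [Inl g]) ` (carrier G - {\<one>\<^bsub>G\<^esub>})))
    (insert [] ((\<lambda>h. [Inr h]) ` (carrier H - {\<one>\<^bsub>H\<^esub>})))"
    (is "is_free_product_of ?P ?A ?B")
proof -
  let ?i = "\<lambda>g. if g = \<one>\<^bsub>G\<^esub> then [] else [Inl g]" and ?j = "\<lambda>h. if h = \<one>\<^bsub>H\<^esub> then [] else [Inr h]"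
  have "?i ` carrier G = ?A" "?j ` carrier H = ?B"
    using G H by (auto simp: image_iff group.is_monoid intro!: bexI[of _ "\<one>\<^bsub>G\<^esub>"] bexI[of _ "\<one>\<^bsub>H\<^esub>"])
  moreover have "subgroup (?i ` carrier G) ?P"
    by (rule group_hom.img_is_subgroup)
      (use free_factor_hom(1)[OF G H] G P in \<open>simp add: group_hom_def group_hom_axioms_def\<close>)
  moreover have "subgroup (?j ` carrier H) ?P"
    by (rule group_hom.img_is_subgroup)
      (use free_factor_hom(2)[OF G H] H P in \<open>simp add: group_hom_def group_hom_axioms_def\<close>)
  ultimately have A: "subgroup ?A ?P" and B: "subgroup ?B ?P"
    by simp_all
  let ?PA = "?P\<lparr>carrier := ?A\<rparr>" and ?PB = "?P\<lparr>carrier := ?B\<rparr>"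
  define \<tau> :: "'a + 'b \<Rightarrow> ('a + 'b) list + ('a + 'b) list"
    where "\<tau> = case_sum (\<lambda>g. Inl [Inl g]) (\<lambda>h. Inr [Inr h])"
  have isl: "isl (\<tau> x) \<longleftrightarrow> isl x" for x
    by (cases x) (simp_all add: \<tau>_def)
  have "letters ?PA ?PB = \<tau> ` letters G H"
    unfolding letters_def \<tau>_def by (auto simp: image_Un image_image)
  then have "lists (letters ?PA ?PB) = map \<tau> ` lists (letters G H)"
    by (simp add: lists_image)
  then have "{w \<in> lists (letters ?PA ?PB). alt w} = map \<tau> ` {w \<in> lists (letters G H). alt (map \<tau> w)}"
    for alt :: "(('a + 'b) list + ('a + 'b) list) list \<Rightarrow> bool"
    by auto
  then have red: "reduced_words ?PA ?PB = map \<tau> ` reduced_words G H"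
    unfolding reduced_words_eq_lists by (simp add: successively_map isl)
  have val: "word_value ?P (map \<tau> w) = w" if "w \<in> reduced_words G H" for w
    using that
  proof (induction w)
    case Nil
    then show ?case by (simp add: word_value_eq_free_hom)
  next
    case (Cons x w)
    then have "word_value ?P (map \<tau> (x # w)) = letter_mult G H x w"
      by (cases x) (auto simp: word_value_eq_free_hom reduced_words_Cons \<tau>_def)
    also have "\<dots> = x # w"
      using Cons.prems by (cases x; cases w; cases "hd w") (auto simp: reduced_words_Cons)
    finally show ?case .
  qed
  have "bij_betw (word_value ?P) (carrier (free_product ?PA ?PB)) (carrier ?P)"
    unfolding bij_betw_def inj_on_def using val by (auto simp: red image_image)
  moreover have "word_value ?P \<in> hom (free_product ?PA ?PB) ?P"
    unfolding word_value_eq_free_hom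
  proof (rule free_hom_hom)
    show "group ?PA" "group ?PB"
      using A B P by (auto intro: subgroup.subgroup_is_group)
    show "id \<in> hom ?PA ?P" "id \<in> hom ?PB ?P"
      using subgroup.subset[OF A] subgroup.subset[OF B] by (auto simp: hom_def)
  qed (rule P)
  ultimately show ?thesis
    unfolding is_free_product_of_def iso_def using A B by blast
qed

section \<open>Ping-pong\<close>

text \<open>
  The inductive step of ping-pong: if the first letters of two words with equal actions come from the
  same factor and differ, their quotient would move a point of \<open>A\<close> to a point of \<open>A\<close>.
\<close>

lemma demonstrative_cancel:
  assumes G: "group G" and \<phi>: "demonstrative \<phi> G A"
    and g: "g \<in> carrier G" "h \<in> carrier G"
    and eq: "\<phi> g \<circ> f = \<phi> h \<circ> f'"
    and A: "f p \<in> A" "f' p \<in> A"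
  shows "g = h \<and> f = f'"
proof -
  interpret G: group G by (rule G)
  have hom: "\<phi> \<in> hom G thompson_V"
    using \<phi> by (simp add: demonstrative_def)
  have \<phi>1: "\<phi> \<one>\<^bsub>G\<^esub> = id"
    using hom_one[OF hom G group_thompson_V] by simp
  have "\<phi> (inv\<^bsub>G\<^esub> h) \<circ> \<phi> h = id"
    using hom_mult[OF hom, of "inv\<^bsub>G\<^esub> h" h] g \<phi>1 by simp
  then have f': "\<phi> (inv\<^bsub>G\<^esub> h \<otimes>\<^bsub>G\<^esub> g) \<circ> f = f'"
    using hom_mult[OF hom, of "inv\<^bsub>G\<^esub> h" g] g eq by (metis G.inv_closed comp_assoc id_comp mult_thompson_V)
  have "inv\<^bsub>G\<^esub> h \<otimes>\<^bsub>G\<^esub> g = \<one>\<^bsub>G\<^esub>"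
  proof (rule ccontr)
    assume "inv\<^bsub>G\<^esub> h \<otimes>\<^bsub>G\<^esub> g \<noteq> \<one>\<^bsub>G\<^esub>"
    then have "\<phi> (inv\<^bsub>G\<^esub> h \<otimes>\<^bsub>G\<^esub> g) ` A \<inter> A = {}"
      using \<phi> g by (simp add: demonstrative_def)
    moreover have "\<phi> (inv\<^bsub>G\<^esub> h \<otimes>\<^bsub>G\<^esub> g) (f p) = f' p"
      using f' by (simp add: fun_eq_iff)
    ultimately show False using A by (metis IntI empty_iff imageI)
  qed
  then show ?thesis
    using f' \<phi>1 g by (metis G.inv_equality G.inv_inv G.inv_closed id_comp)
qed

text \<open>
  Non-empty words send \<open>p\<close> outside \<open>A\<close> or outside \<open>B\<close>, depending on the factor of their first letter, and
  these two regions are disjoint from each other and do not contain \<open>p\<close>. Two words with the same action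
  therefore begin in the same factor, and their first letters cancel.
\<close>

lemma ping_pong:
  assumes G: "group G" and H: "group H"
    and \<phi>: "demonstrative \<phi> G A" and \<psi>: "demonstrative \<psi> H B"
    and AB: "A \<union> B = UNIV" and p: "p \<in> A" "p \<in> B"
  shows "inj_on (free_hom \<phi> \<psi> thompson_V) (reduced_words G H)"
proof -
  let ?\<Psi> = "free_hom \<phi> \<psi> thompson_V"
  have off: "(isl (hd w) \<longrightarrow> ?\<Psi> w p \<notin> A) \<and> (\<not> isl (hd w) \<longrightarrow> ?\<Psi> w p \<notin> B)"
    if "w \<in> reduced_words G H" "w \<noteq> []" for w
    using that
  proof (induction w)
    case (Cons x w)
    have w: "w = [] \<or> isl x \<noteq> isl (hd w)" "w \<in> reduced_words G H" "x \<in> letters G H"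
      using Cons.prems(1) by (auto simp: reduced_words_Cons)
    show ?case
    proof (cases x)
      case (Inl g)
      then have "?\<Psi> w p \<in> A"
        using w Cons.IH AB p by (cases "w = []") auto
      then show ?thesis
        using w(3) \<phi> unfolding Inl demonstrative_def by auto
    next
      case (Inr h)
      then have "?\<Psi> w p \<in> B"
        using w Cons.IH AB p by (cases "w = []") auto
      then show ?thesis
        using w(3) \<psi> unfolding Inr demonstrative_def by auto
    qed
  qed simp
  have inA: "?\<Psi> w p \<in> A" if "w \<in> reduced_words G H" "w = [] \<or> \<not> isl (hd w)" for w
    using off[OF that(1)] that(2) AB p by (cases "w = []") auto
  have inB: "?\<Psi> w p \<in> B" if "w \<in> reduced_words G H" "w = [] \<or> isl (hd w)" for w
    using off[OF that(1)] that(2) AB p by (cases "w = []") auto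
  have "u = v" if "u \<in> reduced_words G H" "v \<in> reduced_words G H" "?\<Psi> u = ?\<Psi> v" for u v
    using that
  proof (induction u arbitrary: v)
    case Nil
    have "?\<Psi> v p = p"
      unfolding Nil.prems(3)[symmetric] by simp
    then show ?case
      using off[OF Nil.prems(2)] p by auto
  next
    case (Cons x u)
    show ?case
    proof (cases v)
      case Nil
      then have "?\<Psi> (x # u) p = p"
        unfolding Cons.prems(3) by simp
      then show ?thesis
        using off[OF Cons.prems(1)] p by auto
    next
      case v: (Cons y v')
      have x: "x \<in> letters G H" "u \<in> reduced_words G H" "u = [] \<or> isl x \<noteq> isl (hd u)"
        using Cons.prems(1) by (auto simp: reduced_words_Cons)
      have y: "y \<in> letters G H" "v' \<in> reduced_words G H" "v' = [] \<or> isl y \<noteq> isl (hd v')"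
        using Cons.prems(2) by (auto simp: v reduced_words_Cons)
      have same: "isl x \<longleftrightarrow> isl y"
      proof -
        have "(isl x \<longrightarrow> ?\<Psi> v p \<notin> A) \<and> (\<not> isl x \<longrightarrow> ?\<Psi> v p \<notin> B)"
          using off[OF Cons.prems(1)] unfolding Cons.prems(3) by simp
        moreover have "(isl y \<longrightarrow> ?\<Psi> v p \<notin> A) \<and> (\<not> isl y \<longrightarrow> ?\<Psi> v p \<notin> B)"
          using off[OF Cons.prems(2)] by (simp add: v)
        ultimately show ?thesis
          using AB by blast
      qed
      have eq: "case_sum \<phi> \<psi> x \<circ> ?\<Psi> u = case_sum \<phi> \<psi> y \<circ> ?\<Psi> v'"
        using Cons.prems(3) by (simp only: v free_hom_simps mult_thompson_V)
      have "x = y \<and> ?\<Psi> u = ?\<Psi> v'"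
      proof (cases x)
        case (Inl g)
        then obtain h where h: "y = Inl h" using same by (cases y) auto
        show ?thesis
          using demonstrative_cancel[OF G \<phi>, of g h "?\<Psi> u" "?\<Psi> v'" p] inA[OF x(2)] inA[OF y(2)]
            x y eq unfolding Inl h by auto
      next
        case (Inr g)
        then obtain h where h: "y = Inr h" using same by (cases y) auto
        show ?thesis
          using demonstrative_cancel[OF H \<psi>, of g h "?\<Psi> u" "?\<Psi> v'" p] inB[OF x(2)] inB[OF y(2)]
            x y eq unfolding Inr h by auto
      qed
      then show ?thesis
        using Cons.IH[OF x(2) y(2)] v by simp
    qed
  qed
  then show ?thesis by (intro inj_onI)
qed

lemma demonstrative_conjugate:
  assumes "demonstrative \<phi> G A" and h: "h \<in> carrier thompson_V"
  shows "demonstrative (\<lambda>g. h \<otimes>\<^bsub>thompson_V\<^esub> \<phi> g \<otimes>\<^bsub>thompson_V\<^esub> inv\<^bsub>thompson_V\<^esub> h) G (h ` A)"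
proof -
  have hom: "\<phi> \<in> hom G thompson_V"
    using assms(1) by (simp add: demonstrative_def)
  have inv: "inv\<^bsub>thompson_V\<^esub> h \<circ> h = id"
    using V.l_inv[OF h] by simp
  have "(\<lambda>g. h \<otimes>\<^bsub>thompson_V\<^esub> \<phi> g \<otimes>\<^bsub>thompson_V\<^esub> inv\<^bsub>thompson_V\<^esub> h) \<in> hom G thompson_V"
  proof (rule homI)
    fix g g' assume g: "g \<in> carrier G" "g' \<in> carrier G"
    have "(h \<circ> \<phi> g \<circ> inv\<^bsub>thompson_V\<^esub> h) \<circ> (h \<circ> \<phi> g' \<circ> inv\<^bsub>thompson_V\<^esub> h) =
        h \<circ> \<phi> g \<circ> (inv\<^bsub>thompson_V\<^esub> h \<circ> h) \<circ> \<phi> g' \<circ> inv\<^bsub>thompson_V\<^esub> h"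
      by (simp only: comp_assoc)
    then show "h \<otimes>\<^bsub>thompson_V\<^esub> \<phi> (g \<otimes>\<^bsub>G\<^esub> g') \<otimes>\<^bsub>thompson_V\<^esub> inv\<^bsub>thompson_V\<^esub> h =
        h \<otimes>\<^bsub>thompson_V\<^esub> \<phi> g \<otimes>\<^bsub>thompson_V\<^esub> inv\<^bsub>thompson_V\<^esub> h \<otimes>\<^bsub>thompson_V\<^esub>
        (h \<otimes>\<^bsub>thompson_V\<^esub> \<phi> g' \<otimes>\<^bsub>thompson_V\<^esub> inv\<^bsub>thompson_V\<^esub> h)"
      using hom_mult[OF hom g] by (simp add: inv comp_assoc)
  next
    fix g assume "g \<in> carrier G"
    then show "h \<otimes>\<^bsub>thompson_V\<^esub> \<phi> g \<otimes>\<^bsub>thompson_V\<^esub> inv\<^bsub>thompson_V\<^esub> h \<in> carrier thompson_V"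
      using h hom_in_carrier[OF hom] by (simp del: mult_thompson_V)
  qed
  moreover have "(h \<circ> \<phi> g \<circ> inv\<^bsub>thompson_V\<^esub> h) ` h ` A \<inter> h ` A = {}"
    if g: "g \<in> carrier G - {\<one>\<^bsub>G\<^esub>}" for g
  proof -
    have "(h \<circ> \<phi> g \<circ> inv\<^bsub>thompson_V\<^esub> h) ` h ` A = h ` \<phi> g ` A"
      by (simp only: image_comp comp_assoc inv comp_id)
    moreover have "inj h"
      using h by (simp add: carrier_thompson_V bij_is_inj)
    ultimately show ?thesis
      using assms(1) g by (simp add: demonstrative_def image_Int[symmetric])
  qed
  ultimately show ?thesis
    by (simp add: demonstrative_def)
qed

definition flip :: "(nat \<Rightarrow> bool) \<Rightarrow> (nat \<Rightarrow> bool)" where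
  "flip x = (\<not> x 0) ## suffix 1 x"

lemma flip_build [simp]: "flip (b ## w) = (\<not> b) ## w"
  by (simp add: flip_def)

lemma flip_flip [simp]: "flip (flip x) = x"
  by (cases x rule: build_cases) simp_all

lemma flip_in_V: "flip \<in> carrier thompson_V"
proof -
  have "bij flip" by (rule o_bij[of flip]) (simp_all add: fun_eq_iff)
  moreover have "prefix_replacing flip"
    by (rule prefix_replacing_charts[where c = "(##)" and h = "\<lambda>b. (##) (\<not> b)"])
      (simp_all, metis build_cases)
  ultimately show ?thesis by (simp add: carrier_thompson_V)
qed

text \<open>
  \<open>shift\<close> sends \<open>cone [True]\<close> onto the complement of the small cone \<open>cone [True, False, False]\<close>, and
  \<open>flip\<close> exchanges the two halves of the Cantor set. Hence \<open>shift \<circ> flip\<close> and its composition with a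
  further \<open>flip\<close> map \<open>cone [False]\<close> onto the complements of two disjoint small cones.
\<close>

lemma overlapping_translates_of_cone:
  obtains h h' p where "h \<in> carrier thompson_V" "h' \<in> carrier thompson_V"
    "h ` cone [False] \<union> h' ` cone [False] = UNIV" "p \<in> h ` cone [False]" "p \<in> h' ` cone [False]"
proof
  let ?h = "shift \<circ> flip"
  let ?h' = "flip \<circ> shift \<circ> flip"
  show h: "?h \<in> carrier thompson_V"
    using V.m_closed[OF shift_in_V flip_in_V] by simp
  show "?h' \<in> carrier thompson_V"
    using V.m_closed[OF flip_in_V h] by (simp add: comp_assoc)
  have A: "x \<in> ?h ` cone [False]" if "x \<notin> cone [True, False, False]" for x
  proof -
    have "\<exists>w. x = shift (True ## w)"
    proof (cases x rule: shift_cases)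
      case (10 w)
      then obtain w' where "w = True ## w'"
        using \<open>x \<notin> cone [True, False, False]\<close> by (cases w rule: build_cases) auto
      then show ?thesis
        using 10 by (metis shift_simps(2))
    qed (metis shift_simps(3,4))+
    then obtain w where "x = ?h (False ## w)"
      by auto
    then show ?thesis
      by (rule image_eqI[where f = ?h]) simp
  qed
  have B: "x \<in> ?h' ` cone [False]" if flip_x: "flip x \<notin> cone [True, False, False]" for x
  proof -
    obtain y where y: "flip x = ?h y" "y \<in> cone [False]"
      using A[OF flip_x] by blast
    have "x = ?h' y"
      using arg_cong[OF y(1), of flip] by simp
    then show ?thesis
      using y(2) by (rule image_eqI[where f = ?h'])
  qed
  have "flip x \<notin> cone [True, False, False]" if "x \<in> cone [True, False, False]" for x
    using that by (cases x rule: build_cases) auto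
  then show "?h ` cone [False] \<union> ?h' ` cone [False] = UNIV"
    using A B by blast
  show "(\<lambda>_. True) \<in> ?h ` cone [False]"
    by (rule A) (auto simp: cone_iff_prefix subsequence_def)
  show "(\<lambda>_. True) \<in> ?h' ` cone [False]"
    by (rule B) (auto simp: cone_iff_prefix subsequence_def flip_def)
qed

theorem theorem1p1:
  fixes K\<^sub>1 :: "('a, 'm) monoid_scheme" and K\<^sub>2 :: "('b, 'n) monoid_scheme"
  assumes "class_A K\<^sub>1" and "class_A K\<^sub>2"
    and "\<not> trivial_group K\<^sub>1" and "\<not> trivial_group K\<^sub>2"
  shows "class_FPV (free_product K\<^sub>1 K\<^sub>2) \<and> embeds_in (free_product K\<^sub>1 K\<^sub>2) thompson_V"
proof -
  have K1: "group K\<^sub>1" and K2: "group K\<^sub>2"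
    using assms(1,2) by (simp_all add: class_A_def)
  obtain \<phi> \<psi> where
    \<phi>: "demonstrative \<phi> K\<^sub>1 (cone [False])" and \<psi>: "demonstrative \<psi> K\<^sub>2 (cone [False])"
    using class_A_demonstrable[OF assms(1)] class_A_demonstrable[OF assms(2)]
    by (auto simp: demonstrable_def)
  obtain h h' p where
    h: "h \<in> carrier thompson_V" "h' \<in> carrier thompson_V"
    and cover: "h ` cone [False] \<union> h' ` cone [False] = UNIV"
      "p \<in> h ` cone [False]" "p \<in> h' ` cone [False]"
    by (rule overlapping_translates_of_cone)
  obtain \<phi>' \<psi>' where
    d: "demonstrative \<phi>' K\<^sub>1 (h ` cone [False])" "demonstrative \<psi>' K\<^sub>2 (h' ` cone [False])"
    using demonstrative_conjugate[OF \<phi> h(1)] demonstrative_conjugate[OF \<psi> h(2)] that by blast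
  let ?P = "free_product K\<^sub>1 K\<^sub>2"
  let ?\<Psi> = "free_hom \<phi>' \<psi>' thompson_V"
  have hom: "\<phi>' \<in> hom K\<^sub>1 thompson_V" "\<psi>' \<in> hom K\<^sub>2 thompson_V"
    using d by (simp_all add: demonstrative_def)
  have inj: "inj_on ?\<Psi> (reduced_words K\<^sub>1 K\<^sub>2)"
    using ping_pong[OF K1 K2 d cover] .
  have \<Psi>: "?\<Psi> \<in> hom ?P thompson_V"
    using free_hom_hom[OF K1 K2 group_thompson_V hom] .
  have P: "group ?P"
    using group_free_product[OF K1 K2 group_thompson_V hom inj] .
  have "subgroup (?\<Psi> ` carrier ?P) thompson_V"
    by (rule group_hom.img_is_subgroup)
      (use P \<Psi> group_thompson_V in \<open>simp add: group_hom_def group_hom_axioms_def\<close>)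
  then have emb: "embeds_in ?P thompson_V"
    using \<Psi> inj unfolding embeds_in_def mon_def by auto
  have "carrier K\<^sub>1 - {\<one>\<^bsub>K\<^sub>1\<^esub>} \<noteq> {}" "carrier K\<^sub>2 - {\<one>\<^bsub>K\<^sub>2\<^esub>} \<noteq> {}"
    using assms(3,4) group.trivial_group_subset[OF K1] group.trivial_group_subset[OF K2] by auto
  then obtain g h where "g \<in> carrier K\<^sub>1 - {\<one>\<^bsub>K\<^sub>1\<^esub>}" "h \<in> carrier K\<^sub>2 - {\<one>\<^bsub>K\<^sub>2\<^esub>}"
    by blast
  then have "insert [] ((\<lambda>g. [Inl g]) ` (carrier K\<^sub>1 - {\<one>\<^bsub>K\<^sub>1\<^esub>})) \<noteq> {\<one>\<^bsub>?P\<^esub>}"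
    "insert [] ((\<lambda>h. [Inr h]) ` (carrier K\<^sub>2 - {\<one>\<^bsub>K\<^sub>2\<^esub>})) \<noteq> {\<one>\<^bsub>?P\<^esub>}"
    by auto
  then have "class_FPV ?P"
    using free_product_is_free_product_of[OF K1 K2 P] P emb unfolding class_FPV_def by blast
  with emb show ?thesis by simp
qed

end
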